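(* Let $d\ge 1$ be a fixed integer and let $\alpha=\alpha(n)>0$ be a sequence. Then $$\lim_{n\to\infty}\mathbb{P}\left(\chi(G_d(n,\alpha))>1\right)=\begin{cases}1 & \text{if } n^2\alpha^d\to\infty,\\ 1-e^{-c\cdot\nu} & \text{if } n^2\alpha^d\to\nu\in(0,\infty),\\ 0 & \text{if } n^2\alpha^d\to 0,\end{cases}$$ where $$c:=\frac{\Gamma((d+3)/2)}{2\cdot(d+1)\cdot\sqrt{\pi}\cdot\Gamma((d+2)/2)}.$$
   Context: $S^d$ is the unit sphere in $\mathbb{R}^{d+1}$ centred at the origin, and $\operatorname{dist}(u,v)$ is the geodesic distance on $S^d$, i.e. the angle between the vectors $u$ and $v$. The random Borsuk graph $G_d(n,\alpha)$ with parameter $\alpha>0$ has $n$ vertices $X_1,\dots,X_n$, chosen i.i.d. uniformly at random on $S^d$, and for $i\ne j$ an edge $X_iX_j$ if and only if $\operatorname{dist}(X_i,X_j)>\pi-\alpha$. $\chi$ denotes the chromatic number and $\Gamma$ the Gamma function. *)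

theory Defs
  imports "HOL-Probability.Probability"
begin

section \<open>Finite simple graphs and chromatic number\<close>

type_synonym 'v ugraph = "'v set \<times> 'v set set"

definition proper_colouring :: "'v ugraph \<Rightarrow> nat \<Rightarrow> ('v \<Rightarrow> nat) \<Rightarrow> bool" where
  "proper_colouring G k f \<longleftrightarrow>
     f ` fst G \<subseteq> {..<k} \<and> (\<forall>u\<in>fst G. \<forall>v\<in>fst G. {u, v} \<in> snd G \<longrightarrow> f u \<noteq> f v)"

definition chromatic_number :: "'v ugraph \<Rightarrow> nat" where
  "chromatic_number G = (LEAST k. \<exists>f. proper_colouring G k f)"

section \<open>Geodesic distance and Borsuk graphs\<close>

text \<open>The sphere \<open>S\<^sup>d\<close> is \<^term>\<open>sphere (0::'a::euclidean_space) 1\<close> with \<open>DIM('a) = d + 1\<close>.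
  The following is the angle between two vectors when both lie on this sphere.\<close>

definition geodesic_dist :: "'a::euclidean_space \<Rightarrow> 'a \<Rightarrow> real" where
  "geodesic_dist u v = arccos (u \<bullet> v)"

text \<open>The vertex \<open>X\<^sub>i\<close> is represented by its index \<open>i\<close>, so that there are
  exactly \<open>n\<close> vertices even if some of the points coincide.\<close>

definition borsuk_graph :: "real \<Rightarrow> nat \<Rightarrow> (nat \<Rightarrow> 'a::euclidean_space) \<Rightarrow> nat ugraph" where
  "borsuk_graph \<alpha> n x =
     ({1..n}, {{i, j} |i j. i \<in> {1..n} \<and> j \<in> {1..n} \<and> i \<noteq> j \<and> geodesic_dist (x i) (x j) > pi - \<alpha>})"

section \<open>The uniform distribution on the unit sphere\<close>

text \<open>Normalised surface measure: the probability of \<open>A \<subseteq> S\<^sup>d\<close> is the proportion of the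
  volume of the unit ball that is occupied by the cone over \<open>A\<close>. The underlying space is the
  sphere itself, so random variables with values in this measure space lie on the sphere.\<close>

definition uniform_sphere :: "'a::euclidean_space measure" where
  "uniform_sphere = restrict_space (distr (uniform_measure lborel (ball 0 1)) borel sgn) (sphere 0 1)"

lemma space_uniform_sphere [simp]: "space uniform_sphere = sphere 0 1"
  by (simp add: uniform_sphere_def space_restrict_space)

lemma sets_uniform_sphere [measurable_cong]:
  "sets uniform_sphere = sets (restrict_space borel (sphere 0 1))"
  by (simp add: uniform_sphere_def sets_restrict_space)

lemma sgn_measurable_euclidean [measurable]:
  "(sgn :: 'a::euclidean_space \<Rightarrow> 'a) \<in> borel_measurable borel"
  unfolding sgn_div_norm[abs_def] by measurable

lemma emeasure_unit_ball:
  "emeasure lborel (ball (0::'a::euclidean_space) 1) \<noteq> 0"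
  "emeasure lborel (ball (0::'a::euclidean_space) 1) \<noteq> \<infinity>"
proof -
  have "emeasure lborel (ball (0::'a) 1) > 0"
    by (simp add: emeasure_ball unit_ball_vol_pos)
  then show "emeasure lborel (ball (0::'a) 1) \<noteq> 0" by simp
  show "emeasure lborel (ball (0::'a) 1) \<noteq> \<infinity>"
    by (simp add: emeasure_ball)
qed

lemma emeasure_uniform_sphere:
  fixes A :: "'a::euclidean_space set"
  assumes A: "A \<in> sets borel" "A \<subseteq> sphere 0 1"
  shows "emeasure uniform_sphere A =
    emeasure lborel {x \<in> ball 0 1. sgn x \<in> A} / emeasure lborel (ball (0::'a) 1)"
proof -
  have "emeasure uniform_sphere A =
      emeasure (uniform_measure lborel (ball 0 1)) (sgn -` A \<inter> space lborel)"
    unfolding uniform_sphere_def using A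
    by (subst emeasure_restrict_space) (auto simp: emeasure_distr)
  also have "\<dots> = emeasure lborel (ball 0 1 \<inter> (sgn -` A)) / emeasure lborel (ball (0::'a) 1)"
    using A measurable_sets[OF sgn_measurable_euclidean, of A]
    by (subst emeasure_uniform_measure) auto
  also have "ball 0 1 \<inter> (sgn -` A) = {x \<in> ball 0 1. sgn x \<in> A}" by auto
  finally show ?thesis .
qed

lemma prob_space_uniform_sphere: "prob_space (uniform_sphere :: 'a::euclidean_space measure)"
proof
  have meas: "{x \<in> ball 0 1. sgn x \<in> sphere 0 1} \<in> sets (lborel :: 'a measure)"
    using measurable_sets[OF sgn_measurable_euclidean[where 'a='a], of "sphere 0 1"]
      sets.Int[of "ball 0 1" borel "sgn -` sphere (0::'a) 1"]
    by (simp add: vimage_def Int_def borel_closed)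
  have "emeasure lborel {x \<in> ball 0 1. sgn x \<in> sphere (0::'a) 1} =
        emeasure lborel (ball (0::'a) 1)"
    by (rule emeasure_eq_AE) (use AE_lborel_singleton[of "0::'a"] meas in \<open>auto simp: norm_sgn elim!: eventually_mono\<close>)
  then show "emeasure uniform_sphere (space (uniform_sphere :: 'a measure)) = 1"
    using emeasure_unit_ball[where 'a='a]
    by (simp add: emeasure_uniform_sphere ennreal_divide_self less_top)
qed

lemma distr_lborel_orthogonal:
  fixes f :: "'a::euclidean_space \<Rightarrow> 'a"
  assumes f: "orthogonal_transformation f"
  shows "distr lborel borel f = lborel"
proof -
  have lin: "linear f" and inj: "inj f" and surj: "surj f" and norm_f: "\<And>x. norm (f x) = norm x"
    using f orthogonal_transformation_inj orthogonal_transformation_surj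
    by (auto simp: orthogonal_transformation)
  have [measurable]: "f \<in> borel_measurable borel"
    using lin by (simp add: linear_continuous_on linear_conv_bounded_linear borel_measurable_continuous_onI)
  define N where "N = distr lborel borel f"
  have setsN[measurable_cong]: "sets N = sets borel" by (simp add: N_def)
  have shift: "(\<integral>\<^sup>+x. g (x + y) \<partial>N) = (\<integral>\<^sup>+x. g x \<partial>N)"
    if [measurable]: "g \<in> borel_measurable borel" for g :: "'a \<Rightarrow> ennreal" and y
  proof -
    obtain z where z: "y = f z" using surj by (metis surjD)
    have "(\<integral>\<^sup>+x. g (x + y) \<partial>N) = (\<integral>\<^sup>+x. g (f (z + x)) \<partial>lborel)"
      by (simp add: N_def nn_integral_distr z linear_add[OF lin] add.commute)
    also have "\<dots> = (\<integral>\<^sup>+x. g (f x) \<partial>distr lborel borel ((+) z))"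
      by (subst nn_integral_distr) auto
    also have "\<dots> = (\<integral>\<^sup>+x. g x \<partial>N)"
      by (simp add: lborel_distr_plus N_def nn_integral_distr)
    finally show ?thesis .
  qed
  have shiftL: "(\<integral>\<^sup>+x. g (x + y) \<partial>lborel) = (\<integral>\<^sup>+x. g x \<partial>lborel)"
    if [measurable]: "g \<in> borel_measurable borel" for g :: "'a \<Rightarrow> ennreal" and y
  proof -
    have "(\<integral>\<^sup>+x. g (x + y) \<partial>lborel) = (\<integral>\<^sup>+x. g x \<partial>distr lborel borel ((+) y))"
      by (subst nn_integral_distr) (auto simp: add.commute)
    then show ?thesis by (simp add: lborel_distr_plus)
  qed
  have ballN: "emeasure N (ball 0 r) = emeasure lborel (ball (0::'a) r)" for r
  proof -
    have "f -` ball 0 r = ball 0 r" by (auto simp: norm_f)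
    then show ?thesis by (simp add: N_def emeasure_distr)
  qed
  interpret N: sigma_finite_measure N
  proof
    show "\<exists>A. countable A \<and> A \<subseteq> sets N \<and> \<Union> A = space N \<and> (\<forall>a\<in>A. emeasure N a \<noteq> \<infinity>)"
    proof (intro exI[of _ "range (\<lambda>n::nat. ball 0 (real n))"] conjI ballI)
      show "\<Union> (range (\<lambda>n::nat. ball (0::'a) (real n))) = space N"
        using reals_Archimedean2 by (auto simp: N_def)
    qed (auto simp: setsN ballN emeasure_ball)
  qed
  interpret P: pair_sigma_finite N "lborel :: 'a measure" ..
  show ?thesis
  proof (rule measure_eqI)
    show "sets (distr lborel borel f) = sets lborel" by simp
    fix A assume "A \<in> sets (distr lborel borel f)"
    then have A[measurable]: "A \<in> sets borel" by simp
    let ?B = "ball (0::'a) 1"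
    have [measurable]: "?B \<in> sets borel" by simp
    let ?i = "indicator :: 'a set \<Rightarrow> 'a \<Rightarrow> ennreal"
    have "emeasure N A * emeasure lborel ?B = (\<integral>\<^sup>+x. ?i A x * (\<integral>\<^sup>+y. ?i ?B y \<partial>lborel) \<partial>N)"
      by (simp add: nn_integral_multc)
    also have "\<dots> = (\<integral>\<^sup>+x. ?i A x * (\<integral>\<^sup>+y. ?i ?B (y + - x) \<partial>lborel) \<partial>N)"
      by (subst shiftL) (auto intro!: borel_measurable_indicator)
    also have "\<dots> = (\<integral>\<^sup>+x. (\<integral>\<^sup>+y. ?i A x * ?i ?B (y - x) \<partial>lborel) \<partial>N)"
    proof -
      have "(\<lambda>y. ?i ?B (y - x)) \<in> borel_measurable lborel" for x by measurable
      then show ?thesis by (simp add: nn_integral_cmult)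
    qed
    also have "\<dots> = (\<integral>\<^sup>+y. (\<integral>\<^sup>+x. ?i A x * ?i ?B (y - x) \<partial>N) \<partial>lborel)"
      by (rule P.Fubini'[symmetric]) simp
    also have "\<dots> = (\<integral>\<^sup>+y. (\<integral>\<^sup>+x. ?i A (x + y) * ?i ?B (y - (x + y)) \<partial>N) \<partial>lborel)"
      by (subst shift[of "\<lambda>x. ?i A x * ?i ?B (_ - x)"]) auto
    also have "\<dots> = (\<integral>\<^sup>+y. (\<integral>\<^sup>+x. ?i A (x + y) * ?i ?B x \<partial>N) \<partial>lborel)"
      by (simp add: indicator_def)
    also have "\<dots> = (\<integral>\<^sup>+x. (\<integral>\<^sup>+y. ?i A (x + y) * ?i ?B x \<partial>lborel) \<partial>N)"
      by (rule P.Fubini') simp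
    also have "\<dots> = (\<integral>\<^sup>+x. (\<integral>\<^sup>+y. ?i A (y + x) \<partial>lborel) * ?i ?B x \<partial>N)"
      by (subst nn_integral_multc[symmetric]) (auto simp: add.commute)
    also have "\<dots> = (\<integral>\<^sup>+x. emeasure lborel A * ?i ?B x \<partial>N)"
      by (subst shiftL) auto
    also have "\<dots> = emeasure lborel A * emeasure lborel ?B"
      by (simp add: nn_integral_cmult setsN ballN)
    finally have "emeasure N A * emeasure lborel ?B = emeasure lborel A * emeasure lborel ?B" .
    then show "emeasure (distr lborel borel f) A = emeasure lborel A"
      using emeasure_unit_ball[where 'a='a]
      unfolding N_def by (metis ennreal_mult_cancel_left mult.commute infinity_ennreal_def)
  qed
qed

lemma uniform_sphere_orthogonal_invariant:
  fixes f :: "'a::euclidean_space \<Rightarrow> 'a"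
  assumes f: "orthogonal_transformation f"
  shows "distr uniform_sphere uniform_sphere f = uniform_sphere"
proof -
  have lin: "linear f" and norm_f: "\<And>x. norm (f x) = norm x"
    using f by (auto simp: orthogonal_transformation)
  have fm[measurable]: "f \<in> borel_measurable borel"
    using lin by (simp add: linear_continuous_on linear_conv_bounded_linear borel_measurable_continuous_onI)
  have fs: "f \<in> measurable uniform_sphere uniform_sphere"
    unfolding measurable_cong_sets[OF sets_uniform_sphere sets_uniform_sphere]
    by (intro measurable_restrict_space3) (auto simp: norm_f)
  show ?thesis
  proof (rule measure_eqI)
    fix A :: "'a set"
    assume "A \<in> sets (distr uniform_sphere uniform_sphere f)"
    then have A: "A \<in> sets uniform_sphere" by simp
    then have A'[measurable]: "A \<in> sets borel" and As: "A \<subseteq> sphere 0 1"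
      by (auto simp: sets_uniform_sphere sets_restrict_space)
    have B: "f -` A \<inter> sphere 0 1 \<in> sets borel"
      using measurable_sets[OF fm A'] by auto
    have sgnf: "sgn (f x) = f (sgn x)" for x
      by (simp add: sgn_div_norm norm_f linear_scale[OF lin])
    have m: "{x \<in> ball 0 1. sgn x \<in> A} \<in> sets borel" by measurable
    have eq: "f -` {x \<in> ball 0 1. sgn x \<in> A} = {x \<in> ball 0 1. sgn x \<in> f -` A \<inter> sphere 0 1}"
      using As by (auto simp: norm_f sgnf)
    have "emeasure (distr uniform_sphere uniform_sphere f) A =
        emeasure uniform_sphere (f -` A \<inter> sphere 0 1)"
      by (simp add: emeasure_distr[OF fs A])
    also have "\<dots> = emeasure lborel (f -` {x \<in> ball 0 1. sgn x \<in> A}) /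
        emeasure lborel (ball (0::'a) 1)"
      unfolding eq by (rule emeasure_uniform_sphere[OF B]) simp
    also have "emeasure lborel (f -` {x \<in> ball 0 1. sgn x \<in> A}) =
        emeasure (distr lborel borel f) {x \<in> ball 0 1. sgn x \<in> A}"
      using emeasure_distr[of f lborel borel, OF _ m] fm by simp
    also have "\<dots> / emeasure lborel (ball (0::'a) 1) = emeasure uniform_sphere A"
      using A' As by (simp add: distr_lborel_orthogonal[OF f] emeasure_uniform_sphere)
    finally show "emeasure (distr uniform_sphere uniform_sphere f) A = emeasure uniform_sphere A" .
  qed simp
qed

end

theory Submission
  imports Defs
begin

text \<open>
  The chromatic number exceeds 1 iff there is an edge. Let \<open>p\<close> be the probability of a given edge; by
  rotation invariance the neighbourhood of every point of the sphere has measure \<open>p\<close>. Adding the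
  points one at a time, the \<open>(k+1)\<close>-st point creates no edge with conditional probability \<open>1 - f\<close>,
  where \<open>f\<close> is the measure of the union of \<open>k\<close> neighbourhoods. Always \<open>f \<le> k p\<close>, and the expectation of
  \<open>f\<close> is exactly \<open>1 - (1 - p)\<^sup>k \<ge> k p - k\<^sup>2 p\<^sup>2\<close>. Hence the probability of no edge among \<open>n\<close> points is
  \<open>exp (- n (n - 1) p / 2)\<close> up to errors of order \<open>n\<^sup>3 p\<^sup>2\<close>, which vanish when \<open>n\<^sup>2 p\<close> converges.
  The cap measure \<open>p\<close> is asymptotically \<open>2 c \<alpha>\<^sup>d\<close>, by comparing the cone over a cap with circular cones
  whose volume is elementary. The case of divergent \<open>n\<^sup>2 \<alpha>\<^sup>d\<close> follows by monotonicity in \<open>\<alpha>\<close>.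
\<close>

section \<open>Edges and the chromatic number\<close>

lemma chromatic_number_borsuk_graph_gt_1_iff:
  "chromatic_number (borsuk_graph \<alpha> n x) > 1 \<longleftrightarrow>
     (\<exists>i\<in>{1..n}. \<exists>j\<in>{1..n}. i \<noteq> j \<and> geodesic_dist (x i) (x j) > pi - \<alpha>)"
  (is "?L \<longleftrightarrow> ?R")
proof
  show ?R if ?L
  proof (rule ccontr)
    assume "\<not> ?R"
    then have "proper_colouring (borsuk_graph \<alpha> n x) 1 (\<lambda>_. 0)"
      unfolding proper_colouring_def borsuk_graph_def by (auto simp: doubleton_eq_iff)
    then have "chromatic_number (borsuk_graph \<alpha> n x) \<le> 1"
      unfolding chromatic_number_def by (intro Least_le) blast
    with that show False by simp
  qed
  show ?L if ?R
  proof (rule ccontr)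
    from that obtain i j where ij: "i \<in> {1..n}" "j \<in> {1..n}" "i \<noteq> j" "geodesic_dist (x i) (x j) > pi - \<alpha>"
      by blast
    assume le: "\<not> ?L"
    \<comment> \<open>Some colouring must exist before the \<open>LEAST\<close> in
      \<open>chromatic_number\<close> is known to be attained. The vertices are \<open>1..n\<close>,
      so \<open>id\<close> takes colours below \<open>Suc n\<close>.\<close>
    have "proper_colouring (borsuk_graph \<alpha> n x) (Suc n) id"
      unfolding proper_colouring_def borsuk_graph_def by (auto simp: doubleton_eq_iff)
    then have "\<exists>f. proper_colouring (borsuk_graph \<alpha> n x) (chromatic_number (borsuk_graph \<alpha> n x)) f"
      unfolding chromatic_number_def by (intro LeastI) (rule exI)
    then obtain f where f: "proper_colouring (borsuk_graph \<alpha> n x) (chromatic_number (borsuk_graph \<alpha> n x)) f" ..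
    have "f ` {1..n} \<subseteq> {..<chromatic_number (borsuk_graph \<alpha> n x)}"
      using f by (simp add: proper_colouring_def borsuk_graph_def)
    then have "f i < chromatic_number (borsuk_graph \<alpha> n x)" "f j < chromatic_number (borsuk_graph \<alpha> n x)"
      using ij by blast+
    \<comment> \<open>\<open>le\<close> leaves 0 as the only possible colour.\<close>
    then have "f i = f j" using le by simp
    moreover have "{i, j} \<in> snd (borsuk_graph \<alpha> n x)" "i \<in> fst (borsuk_graph \<alpha> n x)" "j \<in> fst (borsuk_graph \<alpha> n x)"
      using ij unfolding borsuk_graph_def snd_conv fst_conv by blast+
    then have "f i \<noteq> f j"
      using f unfolding proper_colouring_def by blast
    ultimately show False by simp
  qed
qed

section \<open>Independent sets in random graphs with constant neighbourhood measure\<close>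

text \<open>In the application \<open>R x y\<close> is \<open>x \<bullet> y < t\<close> on the
  sphere. There \<open>R\<close> relates every point to itself once \<open>t > 1\<close>; hence
  \<open>independent\<close> compares distinct indices only.\<close>

locale regular_relation = prob_space U for U :: "'a measure" +
  fixes R :: "'a \<Rightarrow> 'a \<Rightarrow> bool" and p :: real
  assumes R_measurable [measurable]: "Measurable.pred (U \<Otimes>\<^sub>M U) (\<lambda>(x, y). R x y)"
    and R_sym: "R x y \<Longrightarrow> R y x"
    and prob_R: "x \<in> space U \<Longrightarrow> prob {y \<in> space U. R x y} = p"
begin

definition independent :: "'i set \<Rightarrow> ('i \<Rightarrow> 'a) set" where
  "independent I = {x \<in> space (Pi\<^sub>M I (\<lambda>_. U)). \<forall>i\<in>I. \<forall>j\<in>I. i \<noteq> j \<longrightarrow> \<not> R (x i) (x j)}"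

text \<open>Its measure is the conditional probability, given \<open>x\<close>, that one further
  point creates no edge.\<close>

definition unrelated :: "'i set \<Rightarrow> ('i \<Rightarrow> 'a) \<Rightarrow> 'a set" where
  "unrelated I x = {y \<in> space U. \<forall>i\<in>I. \<not> R (x i) y}"

abbreviation q :: "'i set \<Rightarrow> real" where
  "q I \<equiv> measure (Pi\<^sub>M I (\<lambda>_. U)) (independent I)"

lemma prob_space_Pi: "prob_space (Pi\<^sub>M I (\<lambda>_. U))"
  by (rule prob_space_PiM) (rule prob_space_axioms)

lemma R_measurable' [measurable (raw)]:
  "f \<in> measurable N U \<Longrightarrow> g \<in> measurable N U \<Longrightarrow> Measurable.pred N (\<lambda>x. R (f x) (g x))"
  using measurable_compose[OF measurable_Pair R_measurable, of f N g] by simp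

lemma p_bounds: "0 \<le> p" "p \<le> 1"
  using prob_R not_empty prob_le_1 measure_nonneg by (metis ex_in_conv)+

lemma sets_independent [measurable]:
  "finite I \<Longrightarrow> independent I \<in> sets (Pi\<^sub>M I (\<lambda>_. U))"
  unfolding independent_def by measurable

lemma sets_unrelated:
  assumes "finite I" "x \<in> space (Pi\<^sub>M I (\<lambda>_. U))"
  shows "unrelated I x \<in> sets U"
proof -
  have "Measurable.pred U (\<lambda>y. R (x i) y)" if "i \<in> I" for i
  proof -
    have [measurable]: "x i \<in> space U" using assms that by (auto simp: space_PiM)
    show ?thesis by measurable
  qed
  with \<open>finite I\<close> show "unrelated I x \<in> sets U" unfolding unrelated_def by measurable
qed

text \<open>\<open>unrelated I x\<close> is the section at \<open>x\<close> of a measurable subset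
  of the product space, and section measures depend measurably on \<open>x\<close>.\<close>

lemma prob_unrelated_measurable:
  assumes [measurable]: "finite I"
  shows "(\<lambda>x. emeasure U (unrelated I x)) \<in> borel_measurable (Pi\<^sub>M I (\<lambda>_. U))"
proof -
  let ?A = "{z \<in> space (Pi\<^sub>M I (\<lambda>_. U) \<Otimes>\<^sub>M U). \<forall>i\<in>I. \<not> R (fst z i) (snd z)}"
  have A: "?A \<in> sets (Pi\<^sub>M I (\<lambda>_. U) \<Otimes>\<^sub>M U)" by measurable
  have "unrelated I x = Pair x -` ?A" if "x \<in> space (Pi\<^sub>M I (\<lambda>_. U))" for x
    using that by (auto simp: unrelated_def space_pair_measure)
  then show ?thesis
    using measurable_emeasure_Pair[OF A] by (subst measurable_cong) auto
qed

lemma integrable_prob_unrelated: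
  assumes "finite I"
  shows "integrable (Pi\<^sub>M I (\<lambda>_. U)) (\<lambda>x. prob (unrelated I x))"
proof -
  interpret P: prob_space "Pi\<^sub>M I (\<lambda>_. U)" by (rule prob_space_Pi)
  have "(\<lambda>x. prob (unrelated I x)) \<in> borel_measurable (Pi\<^sub>M I (\<lambda>_. U))"
    unfolding measure_def using prob_unrelated_measurable[OF assms] by measurable
  then show ?thesis
    by (intro P.integrable_const_bound[where B=1] AE_I2) auto
qed

text \<open>Union bound: the complement is covered by \<open>card I\<close> neighbourhoods of
  measure \<open>p\<close> each.\<close>

lemma prob_unrelated_ge:
  assumes "finite I" "x \<in> space (Pi\<^sub>M I (\<lambda>_. U))"
  shows "prob (unrelated I x) \<ge> 1 - card I * p"
proof -
  have x: "x i \<in> space U" if "i \<in> I" for i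
    using that assms by (auto simp: space_PiM)
  have S: "{y \<in> space U. R (x i) y} \<in> sets U" if "i \<in> I" for i
    using x[OF that] by measurable
  have "1 - prob (unrelated I x) = prob (space U - unrelated I x)"
    using assms by (simp add: prob_compl sets_unrelated)
  also have "space U - unrelated I x = (\<Union>i\<in>I. {y \<in> space U. R (x i) y})"
    by (auto simp: unrelated_def)
  also have "prob \<dots> \<le> (\<Sum>i\<in>I. prob {y \<in> space U. R (x i) y})"
    using S assms by (intro finite_measure_subadditive_finite) auto
  also have "\<dots> = card I * p" using x by (simp add: prob_R)
  finally show ?thesis by simp
qed

text \<open>Tonelli, integrating out the point with index \<open>k\<close> first: the enlarged
  configuration is independent exactly when the old one is and the new point falls into
  \<open>unrelated I x\<close>.\<close>

lemma q_insert:
  assumes "finite I" "k \<notin> I"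
  shows "q (insert k I) = (\<integral>x. indicator (independent I) x * prob (unrelated I x) \<partial>Pi\<^sub>M I (\<lambda>_. U))"
proof -
  interpret P': prob_space "Pi\<^sub>M (insert k I) (\<lambda>_. U)" by (rule prob_space_Pi)
  interpret product_sigma_finite "\<lambda>_. U" by standard
  \<comment> \<open>\<open>R_sym\<close> reduces the index pairs \<open>(i, k)\<close> and
    \<open>(k, i)\<close> to the one condition in \<open>unrelated\<close>.\<close>
  have mem: "x(k := y) \<in> independent (insert k I) \<longleftrightarrow> x \<in> independent I \<and> y \<in> unrelated I x"
    if "x \<in> space (Pi\<^sub>M I (\<lambda>_. U))" "y \<in> space U" for x y
  proof -
    have "x(k := y) \<in> space (Pi\<^sub>M (insert k I) (\<lambda>_. U))"
      using that by (auto simp: space_PiM PiE_iff extensional_def)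
    then show ?thesis
      using that R_sym \<open>k \<notin> I\<close> unfolding independent_def unrelated_def
      by (auto simp: fun_upd_def)
  qed
  have "ennreal (q (insert k I)) = (\<integral>\<^sup>+z. indicator (independent (insert k I)) z \<partial>Pi\<^sub>M (insert k I) (\<lambda>_. U))"
    using assms by (simp add: P'.emeasure_eq_measure)
  also have "\<dots> = (\<integral>\<^sup>+x. (\<integral>\<^sup>+y. indicator (independent (insert k I)) (x(k := y)) \<partial>U) \<partial>Pi\<^sub>M I (\<lambda>_. U))"
    using assms by (subst product_nn_integral_insert) auto
  also have "\<dots> = (\<integral>\<^sup>+x. (\<integral>\<^sup>+y. indicator (independent I) x * indicator (unrelated I x) y \<partial>U) \<partial>Pi\<^sub>M I (\<lambda>_. U))"
    by (intro nn_integral_cong) (auto simp: mem indicator_def)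
  also have "\<dots> = (\<integral>\<^sup>+x. indicator (independent I) x * emeasure U (unrelated I x) \<partial>Pi\<^sub>M I (\<lambda>_. U))"
    using assms by (intro nn_integral_cong) (simp add: nn_integral_cmult_indicator sets_unrelated)
  also have "\<dots> = (\<integral>\<^sup>+x. ennreal (indicator (independent I) x * prob (unrelated I x)) \<partial>Pi\<^sub>M I (\<lambda>_. U))"
    by (intro nn_integral_cong) (simp add: emeasure_eq_measure indicator_def)
  also have "\<dots> = ennreal (\<integral>x. indicator (independent I) x * prob (unrelated I x) \<partial>Pi\<^sub>M I (\<lambda>_. U))"
    using integrable_real_mult_indicator[OF sets_independent integrable_prob_unrelated] assms
    by (intro nn_integral_eq_integral) (auto simp: mult.commute)
  finally show ?thesis by (simp add: integral_nonneg_AE)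
qed

text \<open>Exchange the integrals. For a fixed new point \<open>y\<close> the old points avoid the
  neighbourhood of \<open>y\<close> independently, so the event is a box with sides of measure
  \<open>1 - p\<close>; since \<open>p\<close> does not depend on \<open>y\<close>, the outer
  integral is that of a constant.\<close>

lemma expectation_prob_unrelated:
  assumes [measurable]: "finite I"
  shows "(\<integral>x. prob (unrelated I x) \<partial>Pi\<^sub>M I (\<lambda>_. U)) = (1 - p) ^ card I"
proof -
  interpret P: prob_space "Pi\<^sub>M I (\<lambda>_. U)" by (rule prob_space_Pi)
  interpret product_sigma_finite "\<lambda>_. U" by standard
  interpret PS: pair_sigma_finite "Pi\<^sub>M I (\<lambda>_. U)" U ..
  have compl: "emeasure U {x \<in> space U. \<not> R x y} = ennreal (1 - p)"
    and S: "{x \<in> space U. \<not> R x y} \<in> sets U" if [measurable]: "y \<in> space U" for y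
  proof -
    have "{x \<in> space U. \<not> R x y} = space U - {x \<in> space U. R y x}" using R_sym by auto
    moreover have "{x \<in> space U. R y x} \<in> sets U" by measurable
    ultimately show "emeasure U {x \<in> space U. \<not> R x y} = ennreal (1 - p)"
      "{x \<in> space U. \<not> R x y} \<in> sets U"
      using that by (simp_all add: emeasure_eq_measure prob_compl prob_R)
  qed
  have "ennreal (\<integral>x. prob (unrelated I x) \<partial>Pi\<^sub>M I (\<lambda>_. U)) =
      (\<integral>\<^sup>+x. emeasure U (unrelated I x) \<partial>Pi\<^sub>M I (\<lambda>_. U))"
    using integrable_prob_unrelated[OF assms]
    by (subst nn_integral_eq_integral[symmetric]) (auto simp: emeasure_eq_measure)
  also have "\<dots> = (\<integral>\<^sup>+x. (\<integral>\<^sup>+y. (if \<forall>i\<in>I. \<not> R (x i) y then 1 else 0) \<partial>U) \<partial>Pi\<^sub>M I (\<lambda>_. U))"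
  proof (intro nn_integral_cong)
    fix x assume "x \<in> space (Pi\<^sub>M I (\<lambda>_. U))"
    then have "emeasure U (unrelated I x) = (\<integral>\<^sup>+y. indicator (unrelated I x) y \<partial>U)"
      by (simp add: sets_unrelated assms)
    also have "\<dots> = (\<integral>\<^sup>+y. (if \<forall>i\<in>I. \<not> R (x i) y then 1 else 0) \<partial>U)"
      by (intro nn_integral_cong) (auto simp: unrelated_def)
    finally show "emeasure U (unrelated I x) = (\<integral>\<^sup>+y. (if \<forall>i\<in>I. \<not> R (x i) y then 1 else 0) \<partial>U)" .
  qed
  also have "\<dots> = (\<integral>\<^sup>+y. (\<integral>\<^sup>+x. (if \<forall>i\<in>I. \<not> R (x i) y then 1 else 0) \<partial>Pi\<^sub>M I (\<lambda>_. U)) \<partial>U)"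
    by (rule PS.Fubini'[symmetric]) measurable
  also have "\<dots> = (\<integral>\<^sup>+y. emeasure (Pi\<^sub>M I (\<lambda>_. U)) (\<Pi>\<^sub>E i\<in>I. {x \<in> space U. \<not> R x y}) \<partial>U)"
  proof (intro nn_integral_cong)
    fix y assume "y \<in> space U"
    then have "emeasure (Pi\<^sub>M I (\<lambda>_. U)) (\<Pi>\<^sub>E i\<in>I. {x \<in> space U. \<not> R x y}) =
        (\<integral>\<^sup>+x. indicator (\<Pi>\<^sub>E i\<in>I. {x \<in> space U. \<not> R x y}) x \<partial>Pi\<^sub>M I (\<lambda>_. U))"
      using S assms by (subst nn_integral_indicator) (auto intro!: sets_PiM_I_finite)
    also have "\<dots> = (\<integral>\<^sup>+x. (if \<forall>i\<in>I. \<not> R (x i) y then 1 else 0) \<partial>Pi\<^sub>M I (\<lambda>_. U))"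
      by (intro nn_integral_cong) (auto simp: indicator_def space_PiM PiE_iff)
    finally show "(\<integral>\<^sup>+x. (if \<forall>i\<in>I. \<not> R (x i) y then 1 else 0) \<partial>Pi\<^sub>M I (\<lambda>_. U)) =
        emeasure (Pi\<^sub>M I (\<lambda>_. U)) (\<Pi>\<^sub>E i\<in>I. {x \<in> space U. \<not> R x y})" ..
  qed
  also have "\<dots> = (\<integral>\<^sup>+y. ennreal (1 - p) ^ card I \<partial>U)"
    using S by (intro nn_integral_cong, subst emeasure_PiM) (auto simp: compl assms)
  also have "\<dots> = ennreal ((1 - p) ^ card I)"
    using p_bounds by (simp add: emeasure_space_1 ennreal_power)
  finally show ?thesis using p_bounds by (simp add: integral_nonneg_AE)
qed

text \<open>Induction: multiplying the bound by \<open>1 - p \<ge> 0\<close> produces a negative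
  cubic term, which is dropped, and the quadratic coefficient \<open>n^2 + n\<close> stays below
  \<open>(n + 1)^2\<close>.\<close>

lemma power_one_minus_le: "(1 - p) ^ n \<le> 1 - real n * p + (real n)\<^sup>2 * p\<^sup>2"
proof (induction n)
  case (Suc n)
  have "(1 - p) ^ Suc n \<le> (1 - p) * (1 - real n * p + (real n)\<^sup>2 * p\<^sup>2)"
    using Suc p_bounds by (auto intro: mult_left_mono)
  also have "\<dots> = 1 - real (Suc n) * p + ((real n)\<^sup>2 + real n) * p\<^sup>2 - p * ((real n)\<^sup>2 * p\<^sup>2)"
    by (simp add: algebra_simps power2_eq_square)
  also have "\<dots> \<le> 1 - real (Suc n) * p + ((real n)\<^sup>2 + real n) * p\<^sup>2" using p_bounds by simp
  also have "\<dots> \<le> 1 - real (Suc n) * p + (real (Suc n))\<^sup>2 * p\<^sup>2"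
    by (intro add_left_mono mult_right_mono) (auto simp: power2_eq_square algebra_simps)
  finally show ?case .
qed simp

text \<open>Write \<open>f\<close> for the measure of \<open>unrelated I x\<close> and
  \<open>c = 1 - card I * p\<close>. The difference \<open>q (insert k I) - c * q I\<close> is the
  integral of \<open>f - c\<close> over the independent configurations. As \<open>f - c\<close> is
  nonnegative everywhere, this lies between 0 and the integral of \<open>f - c\<close> over all
  configurations, which is known exactly.\<close>

lemma q_insert_bounds:
  assumes I: "finite I" "k \<notin> I"
  shows q_insert_ge: "q (insert k I) \<ge> (1 - card I * p) * q I"
    and q_insert_le: "q (insert k I) \<le> (1 - card I * p) * q I + (real (card I))\<^sup>2 * p\<^sup>2"
proof -
  interpret P: prob_space "Pi\<^sub>M I (\<lambda>_. U)" by (rule prob_space_Pi)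
  let ?i = "indicator (independent I) :: _ \<Rightarrow> real" and ?f = "\<lambda>x. prob (unrelated I x)"
  define c where "c = 1 - card I * p"
  have f_ge: "?f x \<ge> c" if "x \<in> space (Pi\<^sub>M I (\<lambda>_. U))" for x
    using prob_unrelated_ge[OF I(1) that] by (simp add: c_def)
  note int = integrable_prob_unrelated[OF I(1)]
  have intf: "integrable (Pi\<^sub>M I (\<lambda>_. U)) (\<lambda>x. ?i x * ?f x)"
    using integrable_real_mult_indicator[OF sets_independent[OF I(1)] int] by (simp add: mult.commute)
  have inti: "integrable (Pi\<^sub>M I (\<lambda>_. U)) (\<lambda>x. ?i x * c)"
    using I by (intro integrable_mult_left integrable_real_indicator) (auto simp: P.emeasure_eq_measure)
  have "(\<integral>x. ?i x * c \<partial>Pi\<^sub>M I (\<lambda>_. U)) = c * q I"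
    using sets_independent[OF I(1)] by (simp add: mult.commute)
  then have eq: "(\<integral>x. ?i x * ?f x - ?i x * c \<partial>Pi\<^sub>M I (\<lambda>_. U)) = q (insert k I) - c * q I"
    using Bochner_Integration.integral_diff[OF intf inti] by (simp only: q_insert[OF I])
  have "0 \<le> (\<integral>x. ?i x * ?f x - ?i x * c \<partial>Pi\<^sub>M I (\<lambda>_. U))"
    using f_ge by (intro integral_nonneg_AE AE_I2) (auto simp: indicator_def)
  then show "q (insert k I) \<ge> (1 - card I * p) * q I" by (simp add: eq flip: c_def)
  \<comment> \<open>Dropping the indicator of independence can only increase the integral, because
    \<open>f \<ge> c\<close>.\<close>
  have "(\<integral>x. ?i x * ?f x - ?i x * c \<partial>Pi\<^sub>M I (\<lambda>_. U)) \<le> (\<integral>x. ?f x - c \<partial>Pi\<^sub>M I (\<lambda>_. U))"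
    using f_ge by (intro integral_mono Bochner_Integration.integrable_diff intf inti int) (auto simp: indicator_def)
  also have "\<dots> = (1 - p) ^ card I - c"
    using int by (simp add: expectation_prob_unrelated[OF I(1)] P.prob_space)
  also have "\<dots> \<le> (real (card I))\<^sup>2 * p\<^sup>2" using power_one_minus_le[of "card I"] by (simp add: c_def)
  finally show "q (insert k I) \<le> (1 - card I * p) * q I + (real (card I))\<^sup>2 * p\<^sup>2"
    by (simp add: eq flip: c_def)
qed

lemma q_empty: "q ({} :: 'i set) = 1"
proof -
  interpret P: prob_space "Pi\<^sub>M ({} :: 'i set) (\<lambda>_. U)" by (rule prob_space_Pi)
  have "independent {} = space (Pi\<^sub>M ({} :: 'i set) (\<lambda>_. U))" by (simp add: independent_def)
  then show ?thesis using P.prob_space by simp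
qed

text \<open>Iterate \<open>q_insert_le\<close> with \<open>1 - n p \<le> exp (- n p)\<close>. The
  exponents add up by \<open>n (n - 1) / 2 + n = (n + 1) n / 2\<close>, and the additive errors
  \<open>n^2 p^2\<close> accumulate to at most \<open>n^3 p^2\<close>, as
  \<open>n^3 + n^2 \<le> (n + 1)^3\<close>.\<close>

lemma q_le:
  assumes "finite I" and "card I = n"
  shows "q I \<le> exp (- (real n * (real n - 1) / 2 * p)) + real n ^ 3 * p\<^sup>2"
  using assms
proof (induction I arbitrary: n)
  case empty
  then show ?case by (simp add: q_empty)
next
  case (insert k I)
  define n where "n = card I"
  have n: "card (insert k I) = Suc n" using insert by (simp add: n_def)
  have "q (insert k I) \<le> (1 - real n * p) * q I + (real n)\<^sup>2 * p\<^sup>2"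
    using q_insert_le insert by (simp add: n_def)
  also have "(1 - real n * p) * q I \<le> exp (- (real n * p)) * q I"
    using exp_ge_add_one_self[of "- (real n * p)"] by (intro mult_right_mono) auto
  also have "\<dots> \<le> exp (- (real n * p)) * (exp (- (real n * (real n - 1) / 2 * p)) + real n ^ 3 * p\<^sup>2)"
    using insert.IH[of n] by (simp add: n_def)
  \<comment> \<open>On the accumulated error the factor \<open>exp (- n p)\<close> is simply bounded
    by 1.\<close>
  also have "\<dots> \<le> exp (- (real n * p)) * exp (- (real n * (real n - 1) / 2 * p)) + 1 * (real n ^ 3 * p\<^sup>2)"
    unfolding distrib_left using p_bounds by (intro add_left_mono mult_right_mono) auto
  also have "exp (- (real n * p)) * exp (- (real n * (real n - 1) / 2 * p)) =
      exp (- (real (Suc n) * (real (Suc n) - 1) / 2 * p))"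
    by (simp add: exp_add[symmetric] field_simps)
  also have "exp (- (real (Suc n) * (real (Suc n) - 1) / 2 * p)) + 1 * (real n ^ 3 * p\<^sup>2) + (real n)\<^sup>2 * p\<^sup>2
     = exp (- (real (Suc n) * (real (Suc n) - 1) / 2 * p)) + (real n ^ 3 + (real n)\<^sup>2) * p\<^sup>2"
    by (simp add: algebra_simps)
  also have "\<dots> \<le> exp (- (real (Suc n) * (real (Suc n) - 1) / 2 * p)) + real (Suc n) ^ 3 * p\<^sup>2"
    by (intro add_left_mono mult_right_mono) (auto simp: power2_eq_square power3_eq_cube algebra_simps)
  finally show ?case using n insert.prems by (simp del: of_nat_Suc)
qed

text \<open>Here the error sits in the exponent, so that iterating \<open>q_insert_ge\<close>
  remains purely multiplicative. Each factor \<open>1 - n p\<close> costs a second-order term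
  \<open>2 (n p)^2\<close>, and these sum to at most \<open>2 n^3 p^2\<close>.\<close>

lemma q_ge:
  assumes "finite I" "card I = n" "real n * p \<le> 1 / 2"
  shows "q I \<ge> exp (- (real n * (real n - 1) / 2 * p) - 2 * real n ^ 3 * p\<^sup>2)"
  using assms
proof (induction I arbitrary: n)
  case empty
  then show ?case by (simp add: q_empty)
next
  case (insert k I)
  define n where "n = card I"
  have n: "card (insert k I) = Suc n" using insert by (simp add: n_def)
  then have np: "real n * p \<le> 1 / 2"
    using insert.prems p_bounds by (simp add: algebra_simps)
  have "- (real (Suc n) * (real (Suc n) - 1) / 2 * p) - 2 * real (Suc n) ^ 3 * p\<^sup>2 \<le>
     - (real (Suc n) * (real (Suc n) - 1) / 2 * p) - 2 * (real n ^ 3 + (real n)\<^sup>2) * p\<^sup>2"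
    by (intro diff_left_mono mult_right_mono) (auto simp: power2_eq_square power3_eq_cube algebra_simps)
  also have "\<dots> = (- (real n * p) - 2 * (real n * p)\<^sup>2) + (- (real n * (real n - 1) / 2 * p) - 2 * real n ^ 3 * p\<^sup>2)"
    by (simp add: power2_eq_square field_simps)
  finally have "exp (- (real (Suc n) * (real (Suc n) - 1) / 2 * p) - 2 * real (Suc n) ^ 3 * p\<^sup>2) \<le>
     exp (- (real n * p) - 2 * (real n * p)\<^sup>2) * exp (- (real n * (real n - 1) / 2 * p) - 2 * real n ^ 3 * p\<^sup>2)"
    unfolding exp_add[symmetric] by simp
  also have "\<dots> \<le> (1 - real n * p) * q I"
  proof (intro mult_mono)
    \<comment> \<open>This is \<open>ln (1 - x) \<ge> - x - 2 x^2\<close> for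
      \<open>0 \<le> x \<le> 1 / 2\<close>, applied to \<open>x = n p\<close>.\<close>
    have "exp (- (real n * p) - 2 * (real n * p)\<^sup>2) \<le> exp (ln (1 - real n * p))"
      unfolding exp_le_cancel_iff using np p_bounds by (intro ln_one_minus_pos_lower_bound) auto
    also have "\<dots> = 1 - real n * p" using np by (intro exp_ln) simp
    finally show "exp (- (real n * p) - 2 * (real n * p)\<^sup>2) \<le> 1 - real n * p" .
  qed (use np insert.IH[of n] in \<open>auto simp: n_def\<close>)
  also have "\<dots> \<le> q (insert k I)" using q_insert_ge insert by (simp add: n_def)
  finally show ?case using n insert.prems by (simp del: of_nat_Suc)
qed

end

section \<open>The measure of a spherical cap\<close>

lemma orthogonal_transformation_exists_euclidean:
  fixes u v :: "'a::euclidean_space"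
  assumes "norm u = norm v"
  obtains f where "orthogonal_transformation f" "f u = v"
proof (cases "u = v")
  case True
  with that[of "\<lambda>x. x"] show ?thesis by simp
next
  case False
  define w where "w = u - v"
  \<comment> \<open>The reflection in the hyperplane orthogonal to \<open>u - v\<close>, which
    exchanges two vectors of equal norm.\<close>
  define f where "f x = x - (2 * (w \<bullet> x) / (w \<bullet> w)) *\<^sub>R w" for x
  have w: "w \<bullet> w \<noteq> 0" using False by (simp add: w_def)
  have "linear f"
    by (rule linearI) (simp_all add: f_def algebra_simps add_divide_distrib)
  moreover have "f x \<bullet> f y = x \<bullet> y" for x y
  proof -
    have "f x \<bullet> f y = x \<bullet> y - 2 * (w \<bullet> x) / (w \<bullet> w) * (w \<bullet> y) - 2 * (w \<bullet> y) / (w \<bullet> w) * (w \<bullet> x)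
        + 2 * (w \<bullet> x) / (w \<bullet> w) * (2 * (w \<bullet> y) / (w \<bullet> w)) * (w \<bullet> w)"
      by (simp add: f_def inner_diff_left inner_diff_right inner_commute algebra_simps)
    also have "\<dots> = x \<bullet> y" using w by (simp add: field_simps)
    finally show ?thesis .
  qed
  ultimately have "orthogonal_transformation f"
    by (simp add: orthogonal_transformation_def)
  \<comment> \<open>Equality of the norms enters here: it gives
    \<open>f u = u - w = v\<close>.\<close>
  moreover have "2 * (w \<bullet> u) = w \<bullet> w"
  proof -
    have "u \<bullet> u = v \<bullet> v" using assms by (simp add: dot_square_norm)
    then show ?thesis by (simp add: w_def inner_diff_left inner_diff_right inner_commute)
  qed
  then have "f u = v" using w by (simp add: f_def) (simp add: w_def)
  ultimately show ?thesis using that by blast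
qed

lemma measurable_id_uniform_sphere: "(\<lambda>x. x) \<in> measurable uniform_sphere borel"
  unfolding measurable_cong_sets[OF sets_uniform_sphere refl]
  by (intro measurable_restrict_space1) simp

text \<open>Pull back along an orthogonal \<open>f\<close> with \<open>f y = x\<close>: it preserves
  the uniform measure, and
  \<open>x \<bullet> f z = f y \<bullet> f z = y \<bullet> z\<close>.\<close>

lemma measure_halfspace_uniform_sphere_cong:
  fixes x y :: "'a::euclidean_space"
  assumes "norm x = norm y"
  shows "measure uniform_sphere {z \<in> space uniform_sphere. x \<bullet> z < t} =
    measure uniform_sphere {z \<in> space uniform_sphere. y \<bullet> z < t}"
proof -
  obtain f where f: "orthogonal_transformation f" "f y = x"
    using orthogonal_transformation_exists_euclidean[of y x] assms by metis
  have norm_f: "norm (f z) = norm z" for z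
    using f by (auto simp: orthogonal_transformation)
  have "linear f" using f by (simp add: orthogonal_transformation)
  then have [measurable]: "f \<in> borel_measurable borel"
    by (simp add: linear_continuous_on linear_conv_bounded_linear borel_measurable_continuous_onI)
  have fs: "f \<in> measurable uniform_sphere uniform_sphere"
    unfolding measurable_cong_sets[OF sets_uniform_sphere sets_uniform_sphere]
    by (intro measurable_restrict_space3) (auto simp: norm_f)
  have [measurable]: "(\<lambda>z. x \<bullet> z) \<in> borel_measurable uniform_sphere"
    by (intro borel_measurable_inner measurable_const measurable_id_uniform_sphere) simp
  have S: "{z \<in> space uniform_sphere. x \<bullet> z < t} \<in> sets (uniform_sphere :: 'a measure)"
    by measurable
  have "measure uniform_sphere {z \<in> space uniform_sphere. x \<bullet> z < t} =
      measure (distr uniform_sphere uniform_sphere f) {z \<in> space uniform_sphere. x \<bullet> z < t}"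
    by (simp only: uniform_sphere_orthogonal_invariant[OF f(1)])
  also have "\<dots> = measure uniform_sphere (f -` {z \<in> space uniform_sphere. x \<bullet> z < t} \<inter> space uniform_sphere)"
    by (rule measure_distr[OF fs S])
  also have "f -` {z \<in> space uniform_sphere. x \<bullet> z < t} \<inter> space uniform_sphere =
      {z \<in> space uniform_sphere. y \<bullet> z < t}"
    using f by (auto simp: norm_f orthogonal_transformation_def)
  finally show ?thesis .
qed

section \<open>Volumes of circular cones\<close>

lemma nn_integral_power_Icc:
  assumes "0 \<le> h"
  shows "(\<integral>\<^sup>+y. ennreal (y ^ n) * indicator {0..h} y \<partial>lborel) = ennreal (h ^ Suc n / Suc n)"
proof -
  have "((\<lambda>y. y ^ Suc n / real (Suc n)) has_real_derivative y ^ n) (at y within S)" for y S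
    using DERIV_cdivide[OF DERIV_pow[of "Suc n" y S], of "real (Suc n)"]
    by (simp del: of_nat_Suc power_Suc)
  then have "(\<integral>\<^sup>+y. ennreal (y ^ n) * indicator {0..h} y \<partial>lborel) =
      ennreal (h ^ Suc n / Suc n - 0 ^ Suc n / Suc n)"
    using assms
    by (intro nn_integral_FTC_Icc[where F="\<lambda>y. y ^ Suc n / Suc n"])
      (auto simp flip: has_real_derivative_iff_has_vector_derivative simp del: of_nat_Suc power_Suc)
  then show ?thesis by simp
qed

text \<open>The circular cone with apex 0, axis \<open>b\<close>, height \<open>h\<close> and slope
  \<open>T\<close>. The square root is the distance from the axis, in coordinates so that a slice
  becomes a ball in the product space over \<open>Basis - {b}\<close>.\<close>

definition solid_cone :: "'a::euclidean_space \<Rightarrow> real \<Rightarrow> real \<Rightarrow> 'a set" where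
  "solid_cone b T h = {z. z \<bullet> b \<in> {0..h} \<and> sqrt (\<Sum>i\<in>Basis - {b}. (z \<bullet> i)\<^sup>2) \<le> T * (z \<bullet> b)}"

lemma sets_solid_cone [measurable]: "solid_cone b T h \<in> sets borel"
  unfolding solid_cone_def by measurable

text \<open>Slice orthogonally to \<open>b\<close>: at height \<open>y\<close> the slice is a
  \<open>d\<close>-dimensional ball of radius \<open>T * y\<close>, and its volume, a multiple of
  \<open>y ^ d\<close>, is integrated over \<open>{0..h}\<close>.\<close>

lemma emeasure_solid_cone:
  fixes b :: "'a::euclidean_space"
  assumes b: "b \<in> Basis" and T: "T > 0" and h: "h \<ge> 0" and d: "DIM('a) = d + 1"
  shows "emeasure lborel (solid_cone b T h) = ennreal (unit_ball_vol d * T ^ d * h ^ (d + 1) / (d + 1))"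
proof -
  interpret product_sigma_finite "\<lambda>_::'a. lborel :: real measure" by standard
  let ?B = "Basis - {b}"
  let ?S = "{f \<in> space (Pi\<^sub>M Basis (\<lambda>_::'a. lborel)). f b \<in> {0..h} \<and> sqrt (\<Sum>i\<in>?B. (f i)\<^sup>2) \<le> T * f b}"
  let ?C = "\<lambda>y. {f. sqrt (\<Sum>i\<in>?B. (f i)\<^sup>2) \<le> T * y} \<inter> space (Pi\<^sub>M ?B (\<lambda>_::'a. lborel))"
  have Bas: "Basis = insert b ?B" using b by auto
  have card: "card ?B = d" using b d by (simp add: card_Diff_singleton)
  have S: "?S \<in> sets (Pi\<^sub>M Basis (\<lambda>_::'a. lborel))"
  proof -
    have comp: "(\<lambda>x. x i) \<in> borel_measurable (Pi\<^sub>M Basis (\<lambda>_::'a. lborel :: real measure))"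
      if "i \<in> Basis" for i
      using measurable_component_singleton[OF that, of "\<lambda>_. lborel :: real measure"] by simp
    have root: "(\<lambda>x. sqrt (\<Sum>i\<in>?B. (x i)\<^sup>2)) \<in> borel_measurable (Pi\<^sub>M Basis (\<lambda>_::'a. lborel :: real measure))"
      by (intro measurable_compose[OF _ borel_measurable_sqrt] borel_measurable_sum borel_measurable_power comp) simp
    have "?S = ((\<lambda>f. f b) -` {0..h} \<inter> space (Pi\<^sub>M Basis (\<lambda>_::'a. lborel))) \<inter>
        {f \<in> space (Pi\<^sub>M Basis (\<lambda>_::'a. lborel)). sqrt (\<Sum>i\<in>?B. (f i)\<^sup>2) \<le> T * f b}" by auto
    also have "\<dots> \<in> sets (Pi\<^sub>M Basis (\<lambda>_::'a. lborel))"
      by (intro sets.Int measurable_sets[OF comp[OF b]] borel_measurable_le root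
          borel_measurable_times borel_measurable_const comp b) simp
    finally show ?thesis .
  qed
  have "emeasure lborel (solid_cone b T h) =
      emeasure (distr (Pi\<^sub>M Basis (\<lambda>_. lborel)) borel (\<lambda>f. \<Sum>i\<in>Basis. f i *\<^sub>R i)) (solid_cone b T h)"
    by (simp flip: lborel_eq)
  also have "\<dots> = emeasure (Pi\<^sub>M Basis (\<lambda>_. lborel)) ?S"
  proof (subst emeasure_distr)
    have "(\<Sum>i\<in>Basis. f i *\<^sub>R i) \<bullet> j = f j" if "j \<in> Basis" for f and j :: 'a
      using that by (simp add: inner_sum_left inner_Basis if_distrib sum.delta cong: if_cong)
    then have "(\<lambda>f. \<Sum>i\<in>Basis. f i *\<^sub>R i) -` solid_cone b T h \<inter> space (Pi\<^sub>M Basis (\<lambda>_::'a. lborel)) = ?S"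
      using b by (auto simp: solid_cone_def)
    then show "emeasure (Pi\<^sub>M Basis (\<lambda>_. lborel))
      ((\<lambda>f. \<Sum>i\<in>Basis. f i *\<^sub>R i) -` solid_cone b T h \<inter> space (Pi\<^sub>M Basis (\<lambda>_::'a. lborel))) =
      emeasure (Pi\<^sub>M Basis (\<lambda>_. lborel)) ?S" by simp
  qed auto
  also have "\<dots> = (\<integral>\<^sup>+f. indicator ?S f \<partial>Pi\<^sub>M Basis (\<lambda>_::'a. lborel))"
    by (rule nn_integral_indicator[OF S, symmetric])
  also have "\<dots> = (\<integral>\<^sup>+f. indicator ?S f \<partial>Pi\<^sub>M (insert b ?B) (\<lambda>_::'a. lborel))"
    by (simp only: Bas[symmetric])
  also have "\<dots> = (\<integral>\<^sup>+y. (\<integral>\<^sup>+f. indicator ?S (f(b := y)) \<partial>Pi\<^sub>M ?B (\<lambda>_::'a. lborel)) \<partial>lborel)"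
    using S by (intro product_nn_integral_insert_rev) (auto simp only: Bas[symmetric] finite_Diff finite_Basis intro!: borel_measurable_indicator)
  also have "\<dots> = (\<integral>\<^sup>+y. ennreal (unit_ball_vol d * T ^ d) * (ennreal (y ^ d) * indicator {0..h} y) \<partial>lborel)"
  \<comment> \<open>The height 0 is discarded as a null set, because the ball formula is applied
    with a positive radius \<open>T * y\<close>. Off \<open>{0..h}\<close> the indicator makes both
    sides vanish.\<close>
  proof (intro nn_integral_cong_AE, use AE_lborel_singleton[of "0::real"] in eventually_elim)
    fix y :: real assume y: "y \<noteq> 0"
    have "(\<integral>\<^sup>+f. indicator ?S (f(b := y)) \<partial>Pi\<^sub>M ?B (\<lambda>_::'a. lborel)) =
      (\<integral>\<^sup>+f. indicator {0..h} y * indicator (?C y) f \<partial>Pi\<^sub>M ?B (\<lambda>_::'a. lborel))"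
    proof (intro nn_integral_cong)
      fix f assume f: "f \<in> space (Pi\<^sub>M ?B (\<lambda>_::'a. lborel :: real measure))"
      then have "f(b := y) \<in> space (Pi\<^sub>M Basis (\<lambda>_::'a. lborel))"
        using b by (auto simp: space_PiM PiE_iff extensional_def)
      moreover have "(\<Sum>i\<in>?B. ((f(b := y)) i)\<^sup>2) = (\<Sum>i\<in>?B. (f i)\<^sup>2)"
        by (intro sum.cong) auto
      ultimately show "indicator ?S (f(b := y)) = (indicator {0..h} y * indicator (?C y) f :: ennreal)"
        using f by (auto simp: indicator_def)
    qed
    also have "\<dots> = indicator {0..h} y * emeasure (Pi\<^sub>M ?B (\<lambda>_. lborel)) (?C y)"
    proof (rule nn_integral_cmult_indicator)
      have "?C y = {f \<in> space (Pi\<^sub>M ?B (\<lambda>_::'a. lborel)). sqrt (\<Sum>i\<in>?B. (f i)\<^sup>2) \<le> T * y}" by auto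
      also have "\<dots> \<in> sets (Pi\<^sub>M ?B (\<lambda>_::'a. lborel))" by measurable
      finally show "?C y \<in> sets (Pi\<^sub>M ?B (\<lambda>_::'a. lborel))" .
    qed
    also have "\<dots> = ennreal (unit_ball_vol d * T ^ d) * (ennreal (y ^ d) * indicator {0..h} y)"
    proof (cases "y \<in> {0..h}")
      case True
      with y T have "T * y > 0" by simp
      have "emeasure (Pi\<^sub>M ?B (\<lambda>_. lborel)) (?C y) = ennreal (unit_ball_vol d * (T * y) ^ d)"
        using emeasure_cball_aux[OF _ \<open>T * y > 0\<close>, of ?B] by (simp add: card)
      also have "unit_ball_vol d * (T * y) ^ d = (unit_ball_vol d * T ^ d) * y ^ d"
        by (simp add: power_mult_distrib)
      finally show ?thesis using True T by (simp add: ennreal_mult)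
    qed simp
    finally show "(\<integral>\<^sup>+f. indicator ?S (f(b := y)) \<partial>Pi\<^sub>M ?B (\<lambda>_::'a. lborel)) =
      ennreal (unit_ball_vol d * T ^ d) * (ennreal (y ^ d) * indicator {0..h} y)" .
  qed
  also have "\<dots> = ennreal (unit_ball_vol d * T ^ d) * ennreal (h ^ Suc d / Suc d)"
    using nn_integral_power_Icc[OF h] by (subst nn_integral_cmult) auto
  also have "\<dots> = ennreal (unit_ball_vol d * T ^ d * h ^ (d + 1) / (d + 1))"
    using T h by (simp flip: ennreal_mult add: add.commute)
  finally show ?thesis .
qed

section \<open>Comparing caps with circular cones\<close>

lemma sum_squares_Basis_minus:
  fixes z :: "'a::euclidean_space"
  assumes "b \<in> Basis"
  shows "(\<Sum>i\<in>Basis - {b}. (z \<bullet> i)\<^sup>2) = (norm z)\<^sup>2 - (z \<bullet> b)\<^sup>2"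
proof -
  have "(norm z)\<^sup>2 = (\<Sum>i\<in>Basis. (z \<bullet> i)\<^sup>2)"
    unfolding power2_norm_eq_inner by (subst euclidean_inner) (simp add: power2_eq_square)
  also have "\<dots> = (z \<bullet> b)\<^sup>2 + (\<Sum>i\<in>Basis - {b}. (z \<bullet> i)\<^sup>2)"
    using assms by (subst sum.remove[of _ b]) auto
  finally show ?thesis by simp
qed

text \<open>A chosen basis vector serves as the unit normal, so that the value depends only on the
  type and \<open>t\<close>; by rotation invariance every other unit vector gives the same
  value.\<close>

definition cap_prob :: "'a::euclidean_space itself \<Rightarrow> real \<Rightarrow> real" where
  "cap_prob _ t = measure uniform_sphere {z \<in> space uniform_sphere. (SOME b :: 'a. b \<in> Basis) \<bullet> z < t}"

lemma measure_halfspace_uniform_sphere: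
  fixes x :: "'a::euclidean_space"
  assumes "x \<in> space uniform_sphere"
  shows "measure uniform_sphere {z \<in> space uniform_sphere. x \<bullet> z < t} = cap_prob TYPE('a) t"
  unfolding cap_prob_def using assms
  by (intro measure_halfspace_uniform_sphere_cong) (simp add: norm_Basis[OF someI_ex[of "\<lambda>b. b \<in> Basis"]] nonempty_Basis ex_in_conv)

text \<open>The part of the unit ball over a cap of angular radius \<alpha> contains a cone of slope
  \<open>sin \<alpha>\<close> and height \<open>cos \<alpha>\<close>, up to its apex, and lies in a
  cone of slope \<open>tan \<alpha>\<close> and height 1. The constant \<kappa> is the volume of the
  cone of slope and height 1 divided by that of the ball.\<close>

lemma cap_prob_cos_bounds:
  fixes \<alpha> :: real
  assumes \<alpha>: "0 < \<alpha>" "\<alpha> < pi / 2" and d: "DIM('a::euclidean_space) = d + 1"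
  defines "\<kappa> \<equiv> unit_ball_vol d / ((d + 1) * unit_ball_vol (real d + 1))"
  shows "cap_prob TYPE('a) (- cos \<alpha>) \<ge> \<kappa> * sin \<alpha> ^ d * cos \<alpha> ^ (d + 1)" (is ?ge)
    and "cap_prob TYPE('a) (- cos \<alpha>) \<le> \<kappa> * tan \<alpha> ^ d" (is ?le)
proof -
  obtain b :: 'a where b: "b \<in> Basis" using nonempty_Basis by blast
  have pos: "sin \<alpha> > 0" "cos \<alpha> > 0" "tan \<alpha> > 0"
    using \<alpha> by (auto intro: sin_gt_zero cos_gt_zero tan_gt_zero)
  have sc: "(sin \<alpha>)\<^sup>2 = 1 - (cos \<alpha>)\<^sup>2" by (simp add: sin_squared_eq)
  \<comment> \<open>With normal \<open>- b\<close> the cap is centred at \<open>b\<close>, the axis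
    of the cones.\<close>
  let ?A = "{z \<in> space uniform_sphere. - b \<bullet> z < - cos \<alpha>}"
  let ?K = "{z \<in> ball 0 1. sgn z \<in> ?A}"
  have [measurable]: "(\<lambda>z. - b \<bullet> z) \<in> borel_measurable uniform_sphere"
    by (intro borel_measurable_inner measurable_const measurable_id_uniform_sphere) simp
  have A: "?A \<in> sets (uniform_sphere :: 'a measure)" by measurable
  have A': "?A \<in> sets borel" "?A \<subseteq> sphere 0 1"
    using A by (auto simp: sets_uniform_sphere sets_restrict_space)
  interpret prob_space "uniform_sphere :: 'a measure" by (rule prob_space_uniform_sphere)
  define V where "V = unit_ball_vol (real d + 1)"
  have v: "V > 0" by (simp add: V_def)
  have \<kappa>: "\<kappa> = unit_ball_vol d / ((real d + 1) * V)" by (simp add: \<kappa>_def V_def add.commute)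
  have p: "prob ?A = cap_prob TYPE('a) (- cos \<alpha>)"
    using b by (intro measure_halfspace_uniform_sphere) (simp add: norm_Basis)
  \<comment> \<open>The origin is excluded because \<open>sgn 0 = 0\<close> lies off the
    sphere.\<close>
  have K: "?K = {z. norm z < 1 \<and> z \<bullet> b > cos \<alpha> * norm z \<and> z \<noteq> 0}"
  proof (intro set_eqI)
    fix z :: 'a
    have "b \<bullet> sgn z = (z \<bullet> b) / norm z"
      by (simp add: sgn_div_norm inner_commute divide_inverse)
    then show "z \<in> ?K \<longleftrightarrow> z \<in> {z. norm z < 1 \<and> z \<bullet> b > cos \<alpha> * norm z \<and> z \<noteq> 0}"
      by (cases "z = 0") (simp_all add: norm_sgn pos_less_divide_eq)
  qed
  have Km [measurable]: "?K \<in> sets borel" using A' by measurable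
  have "ennreal (prob ?A) = emeasure lborel ?K / emeasure lborel (ball (0::'a) 1)"
    using emeasure_uniform_sphere[OF A'] by (simp add: emeasure_eq_measure)
  also have "emeasure lborel (ball (0::'a) 1) = ennreal (V)"
    using d by (simp add: emeasure_ball V_def add.commute)
  finally have h: "ennreal (prob ?A) = emeasure lborel ?K / ennreal (V)" .
  have "ennreal (prob ?A * V) = ennreal (V) * ennreal (prob ?A)"
    using v by (simp add: ennreal_mult mult.commute)
  also have "\<dots> = emeasure lborel ?K * ennreal (V) / ennreal (V)"
    unfolding h by (simp only: ennreal_times_divide mult.commute)
  also have "\<dots> = emeasure lborel ?K"
    using v by (intro ennreal_mult_divide_eq) (auto simp: ennreal_eq_0_iff)
  finally have eq: "emeasure lborel ?K = ennreal (prob ?A * V)" ..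
  \<comment> \<open>The slope is \<open>sin \<alpha> < tan \<alpha>\<close> because the cap is open; the factor \<open>cos \<alpha>\<close> keeps the cone in the ball.\<close>
  have "solid_cone b (sin \<alpha>) (cos \<alpha>) - {0} \<subseteq> ?K"
  proof
    fix z assume "z \<in> solid_cone b (sin \<alpha>) (cos \<alpha>) - {0}"
    then have z: "0 \<le> z \<bullet> b" "z \<bullet> b \<le> cos \<alpha>" "sqrt ((norm z)\<^sup>2 - (z \<bullet> b)\<^sup>2) \<le> sin \<alpha> * (z \<bullet> b)" "z \<noteq> 0"
      using b by (auto simp: solid_cone_def sum_squares_Basis_minus)
    have "(norm z)\<^sup>2 - (z \<bullet> b)\<^sup>2 \<le> (sin \<alpha> * (z \<bullet> b))\<^sup>2"
      using z(3) by (rule sqrt_le_D)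
    then have 1: "(norm z)\<^sup>2 \<le> (1 + (sin \<alpha>)\<^sup>2) * (z \<bullet> b)\<^sup>2"
      by (simp add: algebra_simps power_mult_distrib)
    with \<open>z \<noteq> 0\<close> have "z \<bullet> b \<noteq> 0" by auto
    \<comment> \<open>With \<open>s = sin \<alpha>\<close> the product is
      \<open>(1 - s^2) (1 + s^2) = 1 - s^4 < 1\<close>; this turns the weak bound on the norm into
      the strict inequality that the open cap demands.\<close>
    have "(cos \<alpha>)\<^sup>2 * (1 + (sin \<alpha>)\<^sup>2) = (1 - (sin \<alpha>)\<^sup>2) * (1 + (sin \<alpha>)\<^sup>2)"
      by (simp only: cos_squared_eq)
    also have "\<dots> = 1 - (sin \<alpha>) ^ 4"
      by (simp add: algebra_simps power2_eq_square power4_eq_xxxx)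
    finally have 2: "(cos \<alpha>)\<^sup>2 * (1 + (sin \<alpha>)\<^sup>2) < 1" using pos by simp
    have "(cos \<alpha> * norm z)\<^sup>2 \<le> (cos \<alpha>)\<^sup>2 * ((1 + (sin \<alpha>)\<^sup>2) * (z \<bullet> b)\<^sup>2)"
      using 1 by (simp add: power_mult_distrib mult_left_mono)
    also have "\<dots> = ((cos \<alpha>)\<^sup>2 * (1 + (sin \<alpha>)\<^sup>2)) * (z \<bullet> b)\<^sup>2" by simp
    also have "\<dots> < 1 * (z \<bullet> b)\<^sup>2" using 2 \<open>z \<bullet> b \<noteq> 0\<close> by (intro mult_strict_right_mono) auto
    finally have 3: "cos \<alpha> * norm z < z \<bullet> b" using z(1) by (simp add: power2_less_imp_less)
    also have "\<dots> \<le> cos \<alpha> * 1" using z by simp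
    finally have "norm z < 1" using pos by (simp only: mult_less_cancel_left_pos)
    with 3 z show "z \<in> ?K" unfolding K by simp
  qed
  then have "emeasure lborel (solid_cone b (sin \<alpha>) (cos \<alpha>) - {0}) \<le> emeasure lborel ?K"
    by (intro emeasure_mono) auto
  also have "emeasure lborel (solid_cone b (sin \<alpha>) (cos \<alpha>) - {0}) =
      emeasure lborel (solid_cone b (sin \<alpha>) (cos \<alpha>))"
    by (intro emeasure_Diff_null_set countable_imp_null_set_lborel) auto
  also have "\<dots> = ennreal (unit_ball_vol d * sin \<alpha> ^ d * cos \<alpha> ^ (d + 1) / (d + 1))"
    using pos by (intro emeasure_solid_cone b d) auto
  finally have "ennreal (unit_ball_vol d * sin \<alpha> ^ d * cos \<alpha> ^ (d + 1) / (d + 1)) \<le>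
      ennreal (prob ?A * V)"
    by (simp only: eq)
  then have "unit_ball_vol d * sin \<alpha> ^ d * cos \<alpha> ^ (d + 1) / (d + 1) \<le> prob ?A * V"
    using v by (subst (asm) ennreal_le_iff) auto
  then have "unit_ball_vol d * sin \<alpha> ^ d * cos \<alpha> ^ (d + 1) / (d + 1) / V \<le> prob ?A"
    using v by (simp only: pos_divide_le_eq)
  then show ?ge unfolding p \<kappa> by (simp add: add.commute)
  have "?K \<subseteq> solid_cone b (tan \<alpha>) 1"
  proof
    fix z assume "z \<in> ?K"
    then have z: "norm z < 1" "z \<bullet> b > cos \<alpha> * norm z" "z \<noteq> 0" unfolding K by auto
    have zb: "z \<bullet> b > 0" using z pos by (meson less_trans mult_pos_pos zero_less_norm_iff)
    have "(cos \<alpha> * norm z)\<^sup>2 \<le> (z \<bullet> b)\<^sup>2"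
      using z pos by (intro power_mono) auto
    \<comment> \<open>Divide by \<open>(cos \<alpha>)^2\<close> and use
      \<open>1 / (cos \<alpha>)^2 - 1 = (tan \<alpha>)^2\<close>.\<close>
    then have "(norm z)\<^sup>2 - (z \<bullet> b)\<^sup>2 \<le> (tan \<alpha> * (z \<bullet> b))\<^sup>2"
      using pos by (simp add: tan_def power_mult_distrib power_divide sc field_simps)
    then have "sqrt ((norm z)\<^sup>2 - (z \<bullet> b)\<^sup>2) \<le> tan \<alpha> * (z \<bullet> b)"
      using zb pos by (intro real_le_lsqrt) auto
    moreover have "z \<bullet> b \<le> 1"
      using Basis_le_norm[OF b, of z] z by simp
    ultimately show "z \<in> solid_cone b (tan \<alpha>) 1"
      using b zb by (simp add: solid_cone_def sum_squares_Basis_minus)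
  qed
  then have "emeasure lborel ?K \<le> emeasure lborel (solid_cone b (tan \<alpha>) 1)"
    by (intro emeasure_mono) auto
  then have "prob ?A * V \<le> unit_ball_vol d * tan \<alpha> ^ d / (d + 1)"
    unfolding eq emeasure_solid_cone[OF b pos(3) zero_le_one d]
    using pos by (subst (asm) ennreal_le_iff) auto
  then have "prob ?A \<le> unit_ball_vol d * tan \<alpha> ^ d / (d + 1) / V"
    using v by (simp only: pos_le_divide_eq)
  then show ?le unfolding p \<kappa> by (simp add: add.commute)
qed

section \<open>The random Borsuk graph\<close>

text \<open>Makes the bounds on \<open>q\<close> available for the sphere; the constant
  neighbourhood measure comes from rotation invariance.\<close>

lemma regular_relation_uniform_sphere:
  "regular_relation (uniform_sphere :: 'a::euclidean_space measure) (\<lambda>x y. x \<bullet> y < t) (cap_prob TYPE('a) t)"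
proof (rule regular_relation.intro[OF prob_space_uniform_sphere], unfold_locales)
  have "(fst :: 'a \<times> 'a \<Rightarrow> 'a) \<in> borel_measurable (uniform_sphere \<Otimes>\<^sub>M uniform_sphere)"
    by (rule measurable_compose[OF measurable_fst measurable_id_uniform_sphere])
  moreover have "(snd :: 'a \<times> 'a \<Rightarrow> 'a) \<in> borel_measurable (uniform_sphere \<Otimes>\<^sub>M uniform_sphere)"
    by (rule measurable_compose[OF measurable_snd measurable_id_uniform_sphere])
  ultimately have "(\<lambda>z :: 'a \<times> 'a. fst z \<bullet> snd z) \<in> borel_measurable (uniform_sphere \<Otimes>\<^sub>M uniform_sphere)"
    by (rule borel_measurable_inner)
  then show "Measurable.pred (uniform_sphere \<Otimes>\<^sub>M uniform_sphere) (\<lambda>(x :: 'a, y). x \<bullet> y < t)"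
    unfolding case_prod_beta by measurable
qed (rule measure_halfspace_uniform_sphere | simp add: inner_commute)+

text \<open>The value 2 encodes that for \<open>\<alpha> > \<pi>\<close> any two points are adjacent, even coinciding ones.\<close>

definition adjacency_threshold :: "real \<Rightarrow> real" where
  "adjacency_threshold \<alpha> = (if \<alpha> \<le> pi then - cos \<alpha> else 2)"

text \<open>For \<open>\<alpha> \<le> pi\<close>, \<open>arccos\<close> is strictly decreasing and
  \<open>cos (pi - \<alpha>) = - cos \<alpha>\<close>. For larger \<alpha> both sides are true, as
  \<open>arccos\<close> is nonnegative and inner products of unit vectors are at most 1.\<close>

lemma geodesic_dist_gt_iff:
  fixes x y :: "'a::euclidean_space"
  assumes "x \<in> sphere 0 1" "y \<in> sphere 0 1" "\<alpha> > 0"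
  shows "geodesic_dist x y > pi - \<alpha> \<longleftrightarrow> x \<bullet> y < adjacency_threshold \<alpha>"
proof -
  have xy: "\<bar>x \<bullet> y\<bar> \<le> 1" using Cauchy_Schwarz_ineq2[of x y] assms by simp
  show ?thesis
  proof (cases "\<alpha> \<le> pi")
    case True
    have "pi - \<alpha> = arccos (cos (pi - \<alpha>))" using True assms by (intro arccos_cos[symmetric]) auto
    then have "geodesic_dist x y > pi - \<alpha> \<longleftrightarrow> arccos (x \<bullet> y) > arccos (cos (pi - \<alpha>))"
      by (simp add: geodesic_dist_def)
    also have "\<dots> \<longleftrightarrow> x \<bullet> y < cos (pi - \<alpha>)" using xy by (intro arccos_less_mono) auto
    finally show ?thesis using True by (simp add: adjacency_threshold_def)
  next
    case False
    moreover have "0 \<le> arccos (x \<bullet> y)" using xy by (intro arccos_lbound) auto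
    ultimately show ?thesis using xy by (auto simp: geodesic_dist_def adjacency_threshold_def)
  qed
qed

lemma adjacency_threshold_mono:
  assumes "0 < \<alpha>" "\<alpha> \<le> \<beta>"
  shows "adjacency_threshold \<alpha> \<le> adjacency_threshold \<beta>"
proof -
  have "- cos \<alpha> \<le> 2" using cos_ge_minus_one[of \<alpha>] by linarith
  then show ?thesis
    using assms cos_monotone_0_pi_le[of \<alpha> \<beta>] by (auto simp: adjacency_threshold_def)
qed

text \<open>Formulated on the product space instead of the given probability spaces, so that
  different values of \<alpha> can be compared on the same random points.\<close>

definition edgeless_prob :: "'a::euclidean_space itself \<Rightarrow> real \<Rightarrow> nat \<Rightarrow> real" where
  "edgeless_prob _ \<alpha> n = measure (Pi\<^sub>M {1..n} (\<lambda>_. uniform_sphere :: 'a measure))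
     {x \<in> space (Pi\<^sub>M {1..n} (\<lambda>_. uniform_sphere)).
        \<forall>i\<in>{1..n}. \<forall>j\<in>{1..n}. i \<noteq> j \<longrightarrow> \<not> x i \<bullet> x j < adjacency_threshold \<alpha>}"

lemma sets_edgeless:
  fixes n :: nat
  shows "{x \<in> space (Pi\<^sub>M {1..n} (\<lambda>_. uniform_sphere :: 'a::euclidean_space measure)).
      \<forall>i\<in>{1..n}. \<forall>j\<in>{1..n}. i \<noteq> j \<longrightarrow> \<not> x i \<bullet> x j < t} \<in> sets (Pi\<^sub>M {1..n} (\<lambda>_. uniform_sphere))"
proof -
  note rr = regular_relation_uniform_sphere[where 'a='a and t=t]
  have "regular_relation.independent uniform_sphere (\<lambda>x y :: 'a. x \<bullet> y < t) {1..n} \<in>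
      sets (Pi\<^sub>M {1..n} (\<lambda>_. uniform_sphere))"
    by (rule regular_relation.sets_independent[OF rr]) simp
  then show ?thesis by (simp only: regular_relation.independent_def[OF rr])
qed

text \<open>For fixed points, enlarging \<alpha> can only add edges.\<close>

lemma edgeless_prob_antimono:
  assumes "0 < \<alpha>" "\<alpha> \<le> \<beta>"
  shows "edgeless_prob TYPE('a::euclidean_space) \<beta> n \<le> edgeless_prob TYPE('a) \<alpha> n"
proof -
  interpret P: prob_space "Pi\<^sub>M {1..n} (\<lambda>_. uniform_sphere :: 'a measure)"
    by (intro prob_space_PiM prob_space_uniform_sphere)
  show ?thesis
    unfolding edgeless_prob_def
    using adjacency_threshold_mono[OF assms]
    by (intro P.finite_measure_mono sets_edgeless) fastforce
qed

text \<open>Independence and the uniform marginals make the product measure the joint law of the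
  points, so the event can be evaluated on the product space.\<close>

lemma prob_chromatic_number_borsuk_graph:
  fixes X :: "nat \<Rightarrow> 'w \<Rightarrow> 'a::euclidean_space"
  assumes "prob_space M" and n: "n \<ge> 1" and \<alpha>: "\<alpha> > 0"
    and indep: "prob_space.indep_vars M (\<lambda>_. uniform_sphere) X {1..n}"
    and distr: "\<And>i. i \<in> {1..n} \<Longrightarrow> distr M uniform_sphere (X i) = uniform_sphere"
  shows "measure M {\<omega> \<in> space M. chromatic_number (borsuk_graph \<alpha> n (\<lambda>i. X i \<omega>)) > 1} =
    1 - edgeless_prob TYPE('a) \<alpha> n"
proof -
  interpret prob_space M by fact
  let ?P = "Pi\<^sub>M {1..n} (\<lambda>_. uniform_sphere :: 'a measure)"
  let ?T = "\<lambda>\<omega>. \<lambda>i\<in>{1..n}. X i \<omega>"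
  let ?E = "{x \<in> space ?P. \<forall>i\<in>{1..n}. \<forall>j\<in>{1..n}. i \<noteq> j \<longrightarrow> \<not> x i \<bullet> x j < adjacency_threshold \<alpha>}"
  have rv: "random_variable uniform_sphere (X i)" if "i \<in> {1..n}" for i
    using indep that by (auto simp: indep_vars_def)
  have T: "?T \<in> measurable M ?P" using rv by (intro measurable_restrict) auto
  \<comment> \<open>The characterisation of independence by the joint law is applied to a nonempty
    index set, which \<open>n \<ge> 1\<close> provides.\<close>
  have "distr M ?P ?T = Pi\<^sub>M {1..n} (\<lambda>i. distr M uniform_sphere (X i))"
    using indep n rv by (subst indep_vars_iff_distr_eq_PiM'[symmetric]) auto
  also have "\<dots> = ?P" by (intro PiM_cong) (simp_all add: distr)
  finally have D: "distr M ?P ?T = ?P" .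
  have S: "X i \<omega> \<in> sphere 0 1" if "i \<in> {1..n}" "\<omega> \<in> space M" for i \<omega>
    using measurable_space[OF rv] that by simp
  have "edgeless_prob TYPE('a) \<alpha> n = measure (distr M ?P ?T) ?E"
    unfolding D edgeless_prob_def ..
  also have "\<dots> = prob (?T -` ?E \<inter> space M)"
    by (rule measure_distr[OF T sets_edgeless])
  finally have Q: "edgeless_prob TYPE('a) \<alpha> n = prob (?T -` ?E \<inter> space M)" .
  have compl: "prob (space M - (?T -` ?E \<inter> space M)) = 1 - prob (?T -` ?E \<inter> space M)"
    by (rule prob_compl[OF measurable_sets[OF T sets_edgeless]])
  have "space M - (?T -` ?E \<inter> space M) =
      {\<omega> \<in> space M. chromatic_number (borsuk_graph \<alpha> n (\<lambda>i. X i \<omega>)) > 1}"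
  proof (intro set_eqI)
    fix \<omega>
    show "\<omega> \<in> space M - (?T -` ?E \<inter> space M) \<longleftrightarrow>
        \<omega> \<in> {\<omega> \<in> space M. chromatic_number (borsuk_graph \<alpha> n (\<lambda>i. X i \<omega>)) > 1}"
    proof (cases "\<omega> \<in> space M")
      case True
      then have "?T \<omega> \<in> space ?P" using measurable_space[OF T] by blast
      then have "?T \<omega> \<in> ?E \<longleftrightarrow> (\<forall>i\<in>{1..n}. \<forall>j\<in>{1..n}. i \<noteq> j \<longrightarrow> \<not> X i \<omega> \<bullet> X j \<omega> < adjacency_threshold \<alpha>)"
        by auto
      also have "\<dots> \<longleftrightarrow> (\<forall>i\<in>{1..n}. \<forall>j\<in>{1..n}. i \<noteq> j \<longrightarrow> \<not> geodesic_dist (X i \<omega>) (X j \<omega>) > pi - \<alpha>)"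
        using geodesic_dist_gt_iff[OF S S \<alpha>] True by blast
      finally show ?thesis
        using True unfolding mem_Collect_eq chromatic_number_borsuk_graph_gt_1_iff by blast
    qed simp
  qed
  with compl show ?thesis unfolding Q by (simp only:)
qed

section \<open>Passage to the limit\<close>

lemma tendsto_exp_of_bounds:
  fixes p q :: "nat \<Rightarrow> real"
  assumes le: "\<And>n. q n \<le> exp (- (real n * (real n - 1) / 2 * p n)) + real n ^ 3 * (p n)\<^sup>2"
    and ge: "\<And>n. real n * p n \<le> 1 / 2 \<Longrightarrow>
      q n \<ge> exp (- (real n * (real n - 1) / 2 * p n) - 2 * real n ^ 3 * (p n)\<^sup>2)"
    and lim: "(\<lambda>n. (real n)\<^sup>2 * p n) \<longlonglongrightarrow> \<mu>"
  shows "q \<longlonglongrightarrow> exp (- (\<mu> / 2))"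
proof -
  have "(\<lambda>n. (real n)\<^sup>2 * p n * inverse (real n)) \<longlonglongrightarrow> \<mu> * 0"
    by (intro tendsto_mult lim lim_inverse_n)
  \<comment> \<open>At \<open>n = 0\<close> both sides are 0, so the equality needs no side
    condition. The limit \<open>n p \<rightarrow> 0\<close> both removes the error
    \<open>n^3 p^2 = (n^2 p) (n p)\<close> and ensures \<open>n p \<le> 1 / 2\<close>
    eventually.\<close>
  also have "(\<lambda>n. (real n)\<^sup>2 * p n * inverse (real n)) = (\<lambda>n. real n * p n)"
    by (auto simp: fun_eq_iff field_simps power2_eq_square)
  finally have np: "(\<lambda>n. real n * p n) \<longlonglongrightarrow> 0" by simp
  have "(\<lambda>n. (real n)\<^sup>2 * p n * (real n * p n)) \<longlonglongrightarrow> \<mu> * 0"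
    by (intro tendsto_mult lim np)
  also have "(\<lambda>n. (real n)\<^sup>2 * p n * (real n * p n)) = (\<lambda>n. real n ^ 3 * (p n)\<^sup>2)"
    by (auto simp: fun_eq_iff power2_eq_square power3_eq_cube)
  finally have n3: "(\<lambda>n. real n ^ 3 * (p n)\<^sup>2) \<longlonglongrightarrow> 0" by simp
  have "(\<lambda>n. ((real n)\<^sup>2 * p n - real n * p n) / 2) \<longlonglongrightarrow> (\<mu> - 0) / 2"
    by (intro tendsto_intros lim np) simp
  also have "(\<lambda>n. ((real n)\<^sup>2 * p n - real n * p n) / 2) = (\<lambda>n. real n * (real n - 1) / 2 * p n)"
    by (auto simp: fun_eq_iff field_simps power2_eq_square)
  finally have main: "(\<lambda>n. real n * (real n - 1) / 2 * p n) \<longlonglongrightarrow> \<mu> / 2" by simp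
  show ?thesis
  proof (rule tendsto_sandwich)
    show "\<forall>\<^sub>F n in sequentially. q n \<le> exp (- (real n * (real n - 1) / 2 * p n)) + real n ^ 3 * (p n)\<^sup>2"
      using le by simp
    have "\<forall>\<^sub>F n in sequentially. real n * p n < 1 / 2"
      by (rule order_tendstoD(2)[OF np]) simp
    then show "\<forall>\<^sub>F n in sequentially. exp (- (real n * (real n - 1) / 2 * p n) - 2 * (real n ^ 3 * (p n)\<^sup>2)) \<le> q n"
      by eventually_elim (use ge in \<open>simp add: mult.assoc\<close>)
    have "(\<lambda>n. exp (- (real n * (real n - 1) / 2 * p n)) + real n ^ 3 * (p n)\<^sup>2) \<longlonglongrightarrow> exp (- (\<mu> / 2)) + 0"
      by (intro tendsto_intros main n3)
    then show "(\<lambda>n. exp (- (real n * (real n - 1) / 2 * p n)) + real n ^ 3 * (p n)\<^sup>2) \<longlonglongrightarrow> exp (- (\<mu> / 2))"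
      by simp
    have "(\<lambda>n. exp (- (real n * (real n - 1) / 2 * p n) - 2 * (real n ^ 3 * (p n)\<^sup>2))) \<longlonglongrightarrow> exp (- (\<mu> / 2) - 2 * 0)"
      by (intro tendsto_intros main n3)
    then show "(\<lambda>n. exp (- (real n * (real n - 1) / 2 * p n) - 2 * (real n ^ 3 * (p n)\<^sup>2))) \<longlonglongrightarrow> exp (- (\<mu> / 2))"
      by simp
  qed
qed

text \<open>Convergence of \<open>n^2 \<alpha>^d\<close> forces \<alpha> to 0, by taking
  \<open>d\<close>-th roots. Eventually the cone bounds apply, and both are
  \<open>\<kappa> n^2 \<alpha>^d\<close> times factors tending to 1, since
  \<open>sin \<alpha> / \<alpha>\<close> and \<open>cos \<alpha>\<close> do.\<close>

lemma tendsto_cap_prob: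
  fixes \<alpha> :: "nat \<Rightarrow> real"
  assumes d: "DIM('a::euclidean_space) = d + 1" and "d \<ge> 1"
    and pos: "\<forall>\<^sub>F n in sequentially. \<alpha> n > 0"
    and lim: "(\<lambda>n. (real n)\<^sup>2 * \<alpha> n ^ d) \<longlonglongrightarrow> \<nu>"
  shows "(\<lambda>n. (real n)\<^sup>2 * cap_prob TYPE('a) (adjacency_threshold (\<alpha> n))) \<longlonglongrightarrow>
    unit_ball_vol d / ((real d + 1) * unit_ball_vol (real d + 1)) * \<nu>"
proof -
  define \<kappa> where "\<kappa> = unit_ball_vol d / ((real d + 1) * unit_ball_vol (real d + 1))"
  have "(\<lambda>n. (real n)\<^sup>2 * \<alpha> n ^ d * (inverse (real n))\<^sup>2) \<longlonglongrightarrow> \<nu> * 0\<^sup>2"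
    by (intro tendsto_intros lim lim_inverse_n)
  moreover have "\<forall>\<^sub>F n in sequentially. (real n)\<^sup>2 * \<alpha> n ^ d * (inverse (real n))\<^sup>2 = \<alpha> n ^ d"
    using eventually_gt_at_top[of 0] by eventually_elim (simp add: field_simps)
  ultimately have "(\<lambda>n. \<alpha> n ^ d) \<longlonglongrightarrow> 0"
    by (simp add: tendsto_cong)
  then have "(\<lambda>n. root d (\<alpha> n ^ d)) \<longlonglongrightarrow> root d 0" by (rule tendsto_real_root)
  moreover have "\<forall>\<^sub>F n in sequentially. root d (\<alpha> n ^ d) = \<alpha> n"
    using pos by eventually_elim (use \<open>d \<ge> 1\<close> in \<open>simp add: real_root_power_cancel\<close>)
  ultimately have \<alpha>0: "\<alpha> \<longlonglongrightarrow> 0" by (simp add: tendsto_cong)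
  have "filterlim \<alpha> (at 0) sequentially"
    using \<alpha>0 pos by (auto simp: filterlim_at elim: eventually_mono)
  then have sin: "(\<lambda>n. sin (\<alpha> n) / \<alpha> n) \<longlonglongrightarrow> 1"
    by (rule filterlim_compose[OF sinc_at_0])
  have cos: "(\<lambda>n. cos (\<alpha> n)) \<longlonglongrightarrow> 1" using tendsto_cos[OF \<alpha>0] by simp
  have lt: "\<forall>\<^sub>F n in sequentially. \<alpha> n < pi / 2"
    by (rule order_tendstoD(2)[OF \<alpha>0]) simp
  have low: "(\<lambda>n. \<kappa> * ((real n)\<^sup>2 * \<alpha> n ^ d) * (sin (\<alpha> n) / \<alpha> n) ^ d * cos (\<alpha> n) ^ (d + 1)) \<longlonglongrightarrow> \<kappa> * \<nu> * 1 ^ d * 1 ^ (d + 1)"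
    by (intro tendsto_intros lim sin cos)
  have up: "(\<lambda>n. \<kappa> * ((real n)\<^sup>2 * \<alpha> n ^ d) * (sin (\<alpha> n) / \<alpha> n / cos (\<alpha> n)) ^ d) \<longlonglongrightarrow> \<kappa> * \<nu> * (1 / 1) ^ d"
    by (intro tendsto_intros lim sin cos) simp
  have "(\<lambda>n. (real n)\<^sup>2 * cap_prob TYPE('a) (adjacency_threshold (\<alpha> n))) \<longlonglongrightarrow> \<kappa> * \<nu>"
  proof (rule tendsto_sandwich)
    show "\<forall>\<^sub>F n in sequentially. \<kappa> * ((real n)\<^sup>2 * \<alpha> n ^ d) * (sin (\<alpha> n) / \<alpha> n) ^ d * cos (\<alpha> n) ^ (d + 1)
        \<le> (real n)\<^sup>2 * cap_prob TYPE('a) (adjacency_threshold (\<alpha> n))"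
      using pos lt
    proof eventually_elim
      case (elim n)
      have "\<kappa> * ((real n)\<^sup>2 * \<alpha> n ^ d) * (sin (\<alpha> n) / \<alpha> n) ^ d * cos (\<alpha> n) ^ (d + 1) =
          (real n)\<^sup>2 * (\<kappa> * sin (\<alpha> n) ^ d * cos (\<alpha> n) ^ (d + 1))"
        using elim by (simp add: power_divide)
      also have "\<dots> \<le> (real n)\<^sup>2 * cap_prob TYPE('a) (- cos (\<alpha> n))"
        using cap_prob_cos_bounds(1)[OF elim d] by (intro mult_left_mono) (auto simp: \<kappa>_def add.commute)
      finally show ?case using elim pi_half_less_two by (simp add: adjacency_threshold_def)
    qed
    show "\<forall>\<^sub>F n in sequentially. (real n)\<^sup>2 * cap_prob TYPE('a) (adjacency_threshold (\<alpha> n)) \<le>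
        \<kappa> * ((real n)\<^sup>2 * \<alpha> n ^ d) * (sin (\<alpha> n) / \<alpha> n / cos (\<alpha> n)) ^ d"
      using pos lt
    proof eventually_elim
      case (elim n)
      have "(real n)\<^sup>2 * cap_prob TYPE('a) (- cos (\<alpha> n)) \<le> (real n)\<^sup>2 * (\<kappa> * tan (\<alpha> n) ^ d)"
        using cap_prob_cos_bounds(2)[OF elim d] by (intro mult_left_mono) (auto simp: \<kappa>_def add.commute)
      also have "tan (\<alpha> n) = \<alpha> n * (sin (\<alpha> n) / \<alpha> n / cos (\<alpha> n))"
        using elim by (simp add: tan_def)
      also have "(real n)\<^sup>2 * (\<kappa> * (\<alpha> n * (sin (\<alpha> n) / \<alpha> n / cos (\<alpha> n))) ^ d) =
          \<kappa> * ((real n)\<^sup>2 * \<alpha> n ^ d) * (sin (\<alpha> n) / \<alpha> n / cos (\<alpha> n)) ^ d"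
        unfolding power_mult_distrib by (simp only: mult_ac)
      finally show ?case using elim by (simp add: adjacency_threshold_def)
    qed
  qed (use low up in simp_all)
  then show ?thesis by (simp add: \<kappa>_def)
qed

text \<open>Identifies the constant \<open>c\<close> as half the cap constant \<kappa>; the half
  comes from counting unordered pairs. The powers of \<open>pi\<close> in the two ball volumes
  cancel up to \<open>sqrt pi\<close>.\<close>

lemma unit_ball_vol_ratio:
  "unit_ball_vol d / ((real d + 1) * unit_ball_vol (real d + 1)) / 2 =
     Gamma ((real d + 3) / 2) / (2 * (real d + 1) * sqrt pi * Gamma ((real d + 2) / 2))"
proof -
  have 1: "unit_ball_vol d = pi powr (d / 2) / Gamma ((real d + 2) / 2)"
    by (simp add: unit_ball_vol_def add_divide_distrib)
  have "pi powr ((real d + 1) / 2) = pi powr (d / 2) * sqrt pi"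
    by (simp add: add_divide_distrib powr_add powr_half_sqrt)
  moreover have "(real d + 1) / 2 + 1 = (real d + 3) / 2" by (simp add: field_simps)
  ultimately have 2: "unit_ball_vol (real d + 1) = pi powr (d / 2) * sqrt pi / Gamma ((real d + 3) / 2)"
    by (simp only: unit_ball_vol_def)
  have "Gamma ((real d + 3) / 2) > 0" "Gamma ((real d + 2) / 2) > 0"
    by (auto intro!: Gamma_real_pos)
  moreover have "P / g / (D * (P * s / h)) / 2 = h / (2 * D * s * g)"
    if "P \<noteq> 0" "g \<noteq> 0" "D \<noteq> 0" "s \<noteq> 0" "h \<noteq> 0" for P g D s h :: real
    using that by (simp add: divide_simps)
  ultimately show ?thesis unfolding 1 2 by simp
qed

text \<open>The expected number of edges tends to \<open>c * \<nu>\<close>, and the limit is the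
  Poisson probability of 0 with that mean. The value \<open>\<nu> = 0\<close> is included.
  Positivity is asked eventually so that the lemma also covers sequences like
  \<open>root d (K / n^2)\<close>, which is 0 at \<open>n = 0\<close>.\<close>

lemma tendsto_edgeless_prob:
  fixes \<alpha> :: "nat \<Rightarrow> real" and d :: nat
  assumes d: "DIM('a::euclidean_space) = d + 1" and "d \<ge> 1"
    and "\<forall>\<^sub>F n in sequentially. \<alpha> n > 0"
    and "(\<lambda>n. (real n)\<^sup>2 * \<alpha> n ^ d) \<longlonglongrightarrow> \<nu>"
  defines "c \<equiv> Gamma ((real d + 3) / 2) / (2 * (real d + 1) * sqrt pi * Gamma ((real d + 2) / 2))"
  shows "(\<lambda>n. edgeless_prob TYPE('a) (\<alpha> n) n) \<longlonglongrightarrow> exp (- c * \<nu>)"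
proof -
  note rr = regular_relation_uniform_sphere[where 'a='a]
  have e: "edgeless_prob TYPE('a) a n =
      measure (Pi\<^sub>M {1..n} (\<lambda>_. uniform_sphere))
        (regular_relation.independent uniform_sphere (\<lambda>x y :: 'a. x \<bullet> y < adjacency_threshold a) {1..n})" for a n
    by (simp only: edgeless_prob_def regular_relation.independent_def[OF rr])
  have "(\<lambda>n. edgeless_prob TYPE('a) (\<alpha> n) n) \<longlonglongrightarrow>
      exp (- (unit_ball_vol d / ((real d + 1) * unit_ball_vol (real d + 1)) * \<nu> / 2))"
    unfolding e
    by (intro tendsto_exp_of_bounds[OF _ _ tendsto_cap_prob[OF assms(1-4)]]
        regular_relation.q_le[OF rr] regular_relation.q_ge[OF rr]) simp_all
  also have "unit_ball_vol d / ((real d + 1) * unit_ball_vol (real d + 1)) * \<nu> / 2 = c * \<nu>"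
    unfolding c_def unit_ball_vol_ratio[symmetric] by simp
  finally show ?thesis by simp
qed

section \<open>The three limiting regimes\<close>

theorem theorem3:
  fixes d :: nat
    and \<alpha> :: "nat \<Rightarrow> real"
    and M :: "nat \<Rightarrow> 'w measure"
    and X :: "nat \<Rightarrow> nat \<Rightarrow> 'w \<Rightarrow> 'a::euclidean_space"
    and c :: real
  defines "c \<equiv> Gamma ((real d + 3) / 2) /
                 (2 * (real d + 1) * sqrt pi * Gamma ((real d + 2) / 2))"
  assumes "d \<ge> 1"
    and "DIM('a) = d + 1"
    and "\<And>n. \<alpha> n > 0"
    and "\<And>n. prob_space (M n)"
    and "\<And>n. prob_space.indep_vars (M n) (\<lambda>_. uniform_sphere) (X n) {1..n}"
    and "\<And>n i. i \<in> {1..n} \<Longrightarrow> distr (M n) uniform_sphere (X n i) = uniform_sphere"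
  shows
    "(filterlim (\<lambda>n. (real n)\<^sup>2 * \<alpha> n ^ d) at_top sequentially \<longrightarrow>
       (\<lambda>n. measure (M n) {\<omega> \<in> space (M n).
          chromatic_number (borsuk_graph (\<alpha> n) n (\<lambda>i. X n i \<omega>)) > 1}) \<longlonglongrightarrow> 1) \<and>
     (\<forall>\<nu>>0. (\<lambda>n. (real n)\<^sup>2 * \<alpha> n ^ d) \<longlonglongrightarrow> \<nu> \<longrightarrow>
       (\<lambda>n. measure (M n) {\<omega> \<in> space (M n).
          chromatic_number (borsuk_graph (\<alpha> n) n (\<lambda>i. X n i \<omega>)) > 1}) \<longlonglongrightarrow> 1 - exp (- c * \<nu>)) \<and>
     ((\<lambda>n. (real n)\<^sup>2 * \<alpha> n ^ d) \<longlonglongrightarrow> 0 \<longrightarrow>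
       (\<lambda>n. measure (M n) {\<omega> \<in> space (M n).
          chromatic_number (borsuk_graph (\<alpha> n) n (\<lambda>i. X n i \<omega>)) > 1}) \<longlonglongrightarrow> 0)"
proof -
  let ?P = "\<lambda>n. measure (M n) {\<omega> \<in> space (M n). chromatic_number (borsuk_graph (\<alpha> n) n (\<lambda>i. X n i \<omega>)) > 1}"
  define Q where "Q = (\<lambda>n. edgeless_prob TYPE('a) (\<alpha> n) n)"
  have "\<forall>\<^sub>F n in sequentially. ?P n = 1 - Q n"
    using eventually_ge_at_top[of 1]
    unfolding Q_def
    by eventually_elim (rule prob_chromatic_number_borsuk_graph[OF assms(5) _ assms(4) assms(6) assms(7)])
  then have P: "?P \<longlonglongrightarrow> 1 - l \<longleftrightarrow> (\<lambda>n. 1 - Q n) \<longlonglongrightarrow> 1 - l" for l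
    by (rule tendsto_cong)
  have finite_case: "?P \<longlonglongrightarrow> 1 - exp (- c * \<nu>)" if "(\<lambda>n. (real n)\<^sup>2 * \<alpha> n ^ d) \<longlonglongrightarrow> \<nu>" for \<nu>
    unfolding P Q_def c_def using that assms(2-4)
    by (intro tendsto_diff tendsto_const tendsto_edgeless_prob) auto
  have infinite_case: "?P \<longlonglongrightarrow> 1 - 0" if lim: "filterlim (\<lambda>n. (real n)\<^sup>2 * \<alpha> n ^ d) at_top sequentially"
  proof -
    have "Q \<longlonglongrightarrow> 0"
    proof (rule order_tendstoI)
      fix a :: real assume "a < 0"
      then show "\<forall>\<^sub>F n in sequentially. a < Q n"
        by (intro always_eventually) (auto simp: Q_def edgeless_prob_def intro: less_le_trans)
    next
      fix a :: real assume "a > 0"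
      \<comment> \<open>Chosen so that \<open>- c * K = - \<bar>ln a\<bar> - 1 < ln a\<close>, which
        puts the limit \<open>exp (- c * K)\<close> below \<open>a\<close>.\<close>
      define K where "K = (\<bar>ln a\<bar> + 1) / c"
      have c: "c > 0" unfolding c_def by (intro divide_pos_pos mult_pos_pos Gamma_real_pos) auto
      then have K: "K > 0" by (simp add: K_def)
      have "exp (- c * K) < exp (ln a)" using c by (simp add: K_def)
      then have Ka: "exp (- c * K) < a" using \<open>a > 0\<close> by simp
      \<comment> \<open>The comparison sequence for which \<open>n^2 \<beta>^d\<close> equals
        \<open>K\<close> for all \<open>n \<ge> 1\<close>, so that the convergent case applies to
        it.\<close>
      define \<beta> where "\<beta> n = root d (K / (real n)\<^sup>2)" for n :: nat
      have \<beta>: "\<beta> n > 0" "(real n)\<^sup>2 * \<beta> n ^ d = K" if "n \<ge> 1" for n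
        using that K assms(2) by (auto simp: \<beta>_def real_root_pow_pos2)
      have "(\<lambda>n. edgeless_prob TYPE('a) (\<beta> n) n) \<longlonglongrightarrow> exp (- c * K)"
        unfolding c_def
      proof (intro tendsto_edgeless_prob assms)
        show "\<forall>\<^sub>F n in sequentially. \<beta> n > 0"
          using eventually_ge_at_top[of 1] by eventually_elim (rule \<beta>)
        show "(\<lambda>n. (real n)\<^sup>2 * \<beta> n ^ d) \<longlonglongrightarrow> K"
          by (intro tendsto_eventually, use eventually_ge_at_top[of 1] in eventually_elim) (rule \<beta>)
      qed
      then have "\<forall>\<^sub>F n in sequentially. edgeless_prob TYPE('a) (\<beta> n) n < a"
        using Ka by (rule order_tendstoD(2))
      moreover have "\<forall>\<^sub>F n in sequentially. K \<le> (real n)\<^sup>2 * \<alpha> n ^ d"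
        using lim by (simp add: filterlim_at_top)
      ultimately show "\<forall>\<^sub>F n in sequentially. Q n < a"
        using eventually_ge_at_top[of 1]
      proof eventually_elim
        case (elim n)
        \<comment> \<open>Divergence eventually pushes \<open>n^2 \<alpha>^d\<close> above
          \<open>K\<close>, hence \<alpha> above \<beta>, and monotonicity transfers the bound
          \<open>a\<close>.\<close>
        then have "(real n)\<^sup>2 * \<beta> n ^ d \<le> (real n)\<^sup>2 * \<alpha> n ^ d" using \<beta> by simp
        then have "\<beta> n ^ d \<le> \<alpha> n ^ d" using elim by (simp add: mult_le_cancel_left_pos)
        then have "\<beta> n \<le> \<alpha> n" 
          using \<beta>(1)[OF elim(3)] assms(2) assms(4)[of n] by (subst (asm) power_mono_iff) auto
        then have "Q n \<le> edgeless_prob TYPE('a) (\<beta> n) n"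
          unfolding Q_def using \<beta> elim by (intro edgeless_prob_antimono) auto
        with elim show ?case by simp
      qed
    qed
    then show ?thesis unfolding P by (intro tendsto_diff tendsto_const)
  qed
  \<comment> \<open>The vanishing regime is the convergent one at \<open>\<nu> = 0\<close>, where
    \<open>1 - exp 0 = 0\<close>.\<close>
  show ?thesis using finite_case finite_case[of 0] infinite_case by simp
qed

end
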